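(* Let $\mathrm{Aut}(L_{2,4})$ be the group of linear automorphisms of $L_{2,4}$, let $\mathbb P\mathrm{Aut}(L_{2,4})$ be its quotient by the nonzero complex scalar matrices, let $\mathrm{Aut}_{\mathbb R}(L_{2,4})$ be the subgroup of real matrices in $\mathrm{Aut}(L_{2,4})$, and let $\mathbb P_+\mathrm{Aut}_{\mathbb R}(L_{2,4})$ be the quotient of $\mathrm{Aut}_{\mathbb R}(L_{2,4})$ by positive real scalar matrices. Then: (1) $\mathbb P\mathrm{Aut}(L_{2,4})$ has order $11520=768\cdot 15$ and is generated by classes of linear automorphisms of $L_{2,4}$ whose matrices have rational entries. (2) $\mathbb P_+\mathrm{Aut}_{\mathbb R}(L_{2,4})$ has order $23040$ and is isomorphic to the Weyl group $D_6$. (3) The set of non-negative elements of $\mathbb P_+\mathrm{Aut}_{\mathbb R}(L_{2,4})$ (classes containing a matrix with all entries real and non-negative) is a subgroup of order $24$, and it acts by relabeling the vertices of $K_4$ (its elements are the classes of the edge permutations of $K_4$ induced by permutations of the four vertices).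
   Context: Coordinates of $\mathbb C^6$ are indexed by the six edges $\{i,j\}$ of $K_4$. For a complex configuration ${\bf p}=({\bf p}_1,\dots,{\bf p}_4)$ in $\mathbb C^2$, $m({\bf p})\in\mathbb C^6$ has coordinates $m_{ij}({\bf p})=\sum_{k=1}^2({\bf p}_i^k-{\bf p}_j^k)^2$ (no conjugation); $M_{2,4}$ is the image of $m$. With $s:\mathbb C^6\to\mathbb C^6$ the coordinatewise squaring map, $L_{2,4}=s^{-1}(M_{2,4})$. A linear automorphism of $L_{2,4}$ is a non-singular $6\times 6$ complex matrix mapping $L_{2,4}$ bijectively onto itself. A class in $\mathbb P_+\mathrm{Aut}_{\mathbb R}(L_{2,4})$ is called non-negative if it contains a matrix with only real non-negative entries (then all its members are such). *)

theory Defs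
  imports "HOL-Analysis.Analysis" "HOL-Algebra.Coset" "HOL-Algebra.Generated_Groups"
begin

text \<open>Edges of K4 (vertices 0,1,2,3); coordinates of C^6 are indexed by edges.\<close>
datatype edge = E01 | E02 | E03 | E12 | E13 | E23

lemma edge_UNIV: "(UNIV :: edge set) = {E01, E02, E03, E12, E13, E23}"
  using edge.exhaust by auto

instance edge :: finite
  by standard (simp add: edge_UNIV)

fun endpts :: "edge \<Rightarrow> nat \<times> nat" where
  "endpts E01 = (0,1)" | "endpts E02 = (0,2)" | "endpts E03 = (0,3)"
| "endpts E12 = (1,2)" | "endpts E13 = (1,3)" | "endpts E23 = (2,3)"

text \<open>The edge with endpoint set {a,b}.\<close>
definition mk_edge :: "nat \<Rightarrow> nat \<Rightarrow> edge" where
  "mk_edge x y = (THE d. endpts d = (min x y, max x y))"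

text \<open>Squared-edge-length map (no conjugation) of a configuration of 4 points in C^2.\<close>
definition mmap :: "(nat \<Rightarrow> complex ^ 2) \<Rightarrow> complex ^ edge" where
  "mmap p = (\<chi> e. \<Sum>k\<in>UNIV. (p (fst (endpts e)) $ k - p (snd (endpts e)) $ k) ^ 2)"

definition M24 :: "(complex ^ edge) set" where
  "M24 = range mmap"

definition sqmap :: "complex ^ edge \<Rightarrow> complex ^ edge" where
  "sqmap v = (\<chi> e. (v $ e) ^ 2)"

definition L24 :: "(complex ^ edge) set" where
  "L24 = sqmap -` M24"

definition lin_aut :: "complex ^ edge ^ edge \<Rightarrow> bool" where
  "lin_aut A \<longleftrightarrow> invertible A \<and> (\<lambda>v. A *v v) ` L24 = L24"

definition Aut :: "(complex ^ edge ^ edge) monoid" where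
  "Aut = \<lparr>carrier = {A. lin_aut A}, mult = (**), one = mat 1\<rparr>"

definition AutR :: "(complex ^ edge ^ edge) monoid" where
  "AutR = \<lparr>carrier = {A. lin_aut A \<and> (\<forall>i j. A $ i $ j \<in> \<real>)}, mult = (**), one = mat 1\<rparr>"

definition scalars :: "(complex ^ edge ^ edge) set" where
  "scalars = {mat c | c. c \<noteq> 0}"

definition pos_scalars :: "(complex ^ edge ^ edge) set" where
  "pos_scalars = {mat (complex_of_real r) | r. r > 0}"

definition PAut where "PAut = Aut Mod scalars"

definition PAutR where "PAutR = AutR Mod pos_scalars"

definition nonneg_classes :: "(complex ^ edge ^ edge) set set" where
  "nonneg_classes = {C \<in> carrier PAutR. \<exists>A\<in>C. \<forall>i j. A $ i $ j \<in> \<real> \<and> Re (A $ i $ j) \<ge> 0}"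

text \<open>Edge permutation induced by a vertex permutation, and its permutation matrix.\<close>
definition edge_perm :: "(nat \<Rightarrow> nat) \<Rightarrow> edge \<Rightarrow> edge" where
  "edge_perm \<sigma> e = mk_edge (\<sigma> (fst (endpts e))) (\<sigma> (snd (endpts e)))"

definition perm_mat :: "(nat \<Rightarrow> nat) \<Rightarrow> complex ^ edge ^ edge" where
  "perm_mat \<sigma> = (\<chi> i j. if i = edge_perm \<sigma> j then 1 else 0)"

text \<open>Weyl group of type D6: signed 6x6 permutation matrices with an even number of
  entries equal to -1, under matrix multiplication.\<close>
definition signed_perm_mat :: "real ^ 6 ^ 6 \<Rightarrow> bool" where
  "signed_perm_mat M \<longleftrightarrow> (\<forall>i j. M $ i $ j \<in> {-1, 0, 1})
     \<and> (\<forall>i. \<exists>!j. M $ i $ j \<noteq> 0) \<and> (\<forall>j. \<exists>!i. M $ i $ j \<noteq> 0)"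

definition WeylD6 :: "(real ^ 6 ^ 6) monoid" where
  "WeylD6 = \<lparr>carrier = {M. signed_perm_mat M \<and> even (card {(i, j). M $ i $ j = -1})},
             mult = (**), one = mat 1\<rparr>"

end

theory Submission
  imports Defs "HOL-Computational_Algebra.Fundamental_Theorem_Algebra"
begin

text \<open>
  Replacing each pair of opposite edge lengths by their sum and difference turns the Cayley-Menger
  equation of \<open>L24\<close> into \<open>p\<^sub>2\<^sup>3 - 6 p\<^sub>2 p\<^sub>4 + 8 p\<^sub>6 + 48 x\<^sub>1\<cdots>x\<^sub>6 = 0\<close> with power sums \<open>p\<^sub>k\<close>, which is
  visibly invariant under signed permutations with an even number of signs.

  Conversely, restricted to a generic line the sextic has six distinct roots, so a linear automorphism,
  which preserves its zero set, multiplies it by a constant and hence preserves its triple points. These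
  are the multiples of the sign vectors with an odd number of minus signs. The quadratic forms
  vanishing on those vectors are the diagonal ones of trace zero, and a matrix preserving this space
  of forms is a scalar multiple of a signed permutation.

  In edge lengths, the triple points are the vectors supported on the star of a vertex with equal
  squares there. A non-negative automorphism therefore permutes the stars up to positive factors,
  so it comes from a permutation of the vertices.
\<close>

section \<open>The equation of \<open>L24\<close>\<close>

text \<open>Equal zero sets give proportional polynomials only in the absence of repeated factors.
  Six distinct roots on one line replace any factorization theory, but one line controls only its
  own points. Hence the direction is kept fixed and the base point varies: first near the good line,
  where the roots stay distinct, then everywhere, because both sides are polynomials in the
  displacement.

  Order three is the convenient order of vanishing because the conditions used then involve nothing
  beyond the Hessian. Its diagonal makes all squared coordinates roots of a single quadratic, and
  its off-diagonal entries decide the remaining cases.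

  The two group orders differ by the treatment of \<open>-1\<close>. There are
  \<open>2^5 * 6! = 23040\<close> signed permutations with an even number of signs, and
  \<open>-1\<close> is one of them because six is even. Positive scalars separate \<open>N\<close>
  from \<open>-N\<close>, complex scalars identify them, which halves the order. A negative real
  scalar never contributes a new class, as its sign can be moved into the signed
  permutation.\<close>

lemma sum_edge: "(\<Sum>e\<in>UNIV. f e) = f E01 + f E02 + f E03 + f E12 + f E13 + f E23"
  for f :: "edge \<Rightarrow> 'a::comm_monoid_add"
  by (simp add: edge_UNIV add.assoc)

lemma prod_edge: "(\<Prod>e\<in>UNIV. f e) = f E01 * f E02 * f E03 * f E12 * f E13 * f E23"
  for f :: "edge \<Rightarrow> 'a::comm_monoid_mult"
  by (simp add: edge_UNIV mult.assoc)

lemma all_edge: "(\<forall>e. P e) \<longleftrightarrow> P E01 \<and> P E02 \<and> P E03 \<and> P E12 \<and> P E13 \<and> P E23"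
  by (metis edge.exhaust)

section \<open>Gram matrices of three vectors in the complex plane\<close>

definition det3 :: "complex \<Rightarrow> complex \<Rightarrow> complex \<Rightarrow> complex \<Rightarrow> complex \<Rightarrow> complex \<Rightarrow> complex" where
  "det3 p q r a b c = p * q * r + 2 * a * b * c - p * c\<^sup>2 - q * b\<^sup>2 - r * a\<^sup>2"

text \<open>Realizability of the symmetric matrix with diagonal \<open>p, q, r\<close> and entries
  \<open>a, b, c\<close> in positions 12, 13, 23 as a Gram matrix for the bilinear form without
  conjugation; \<open>det3\<close> is its determinant.\<close>

definition gram_vectors :: "complex \<Rightarrow> complex \<Rightarrow> complex \<Rightarrow> complex \<Rightarrow> complex \<Rightarrow> complex \<Rightarrow> bool" where
  "gram_vectors p q r a b c \<longleftrightarrow> (\<exists>u1 u2 v1 v2 w1 w2. u1\<^sup>2 + u2\<^sup>2 = p \<and> v1\<^sup>2 + v2\<^sup>2 = q \<and> w1\<^sup>2 + w2\<^sup>2 = r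
     \<and> u1 * v1 + u2 * v2 = a \<and> u1 * w1 + u2 * w2 = b \<and> v1 * w1 + v2 * w2 = c)"

lemma gram_vectors_swap12: "gram_vectors p q r a b c \<Longrightarrow> gram_vectors q p r a c b"
  unfolding gram_vectors_def by (metis mult.commute)

lemma gram_vectors_swap23: "gram_vectors p q r a b c \<Longrightarrow> gram_vectors p r q b a c"
  unfolding gram_vectors_def by (metis mult.commute)

lemma det3_swap: "det3 q p r a c b = det3 p q r a b c" "det3 p r q b a c = det3 p q r a b c"
  by (simp_all add: det3_def algebra_simps)

lemma rank1_sym2:
  fixes p q r :: complex
  assumes "p * r = q\<^sup>2"
  obtains x y where "x\<^sup>2 = p" "y\<^sup>2 = r" "x * y = q"
proof (cases "p = 0")
  case True
  then show ?thesis using assms that[of 0 "csqrt r"] by simp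
next
  case False
  have "(q / csqrt p)\<^sup>2 = r"
    using False assms by (simp add: power_divide field_simps)
  then show ?thesis using False that[of "csqrt p" "q / csqrt p"] by simp
qed

lemma gram_vectors_nonisotropic:
  assumes "p \<noteq> 0" "det3 p q r a b c = 0"
  shows "gram_vectors p q r a b c"
proof -
  define s where "s = csqrt p"
  have s: "s\<^sup>2 = p" "s \<noteq> 0" using assms by (auto simp: s_def)
  \<comment> \<open>With the first vector placed at \<open>(s, 0)\<close>, the second coordinates of
    the other two must realize the Schur complement of \<open>p\<close>. It is singular because
    \<open>det3\<close> is \<open>p\<close> times its determinant.\<close>
  have "p * ((q - a\<^sup>2 / p) * (r - b\<^sup>2 / p)) = p * (c - a * b / p)\<^sup>2"
    using assms by (simp add: det3_def field_simps power2_eq_square) algebra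
  then have "(q - a\<^sup>2 / p) * (r - b\<^sup>2 / p) = (c - a * b / p)\<^sup>2"
    using assms(1) by simp
  then obtain x y where xy: "x\<^sup>2 = q - a\<^sup>2 / p" "y\<^sup>2 = r - b\<^sup>2 / p" "x * y = c - a * b / p"
    by (rule rank1_sym2)
  show ?thesis unfolding gram_vectors_def
    apply (rule exI[of _ s], rule exI[of _ 0], rule exI[of _ "a / s"], rule exI[of _ x],
        rule exI[of _ "b / s"], rule exI[of _ y])
    using s xy by (simp add: power_divide power2_eq_square)
qed

text \<open>The vectors \<open>(1, \<i>)\<close> and \<open>(1, -\<i>)\<close> are isotropic but not orthogonal.\<close>
lemma gram_vectors_isotropic: "gram_vectors 0 0 0 a b 0"
  unfolding gram_vectors_def
  apply (rule exI[of _ "1/2"], rule exI[of _ "- \<i> / 2"], rule exI[of _ a], rule exI[of _ "\<i> * a"],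
      rule exI[of _ b], rule exI[of _ "\<i> * b"])
  by (simp add: power_mult_distrib power_divide power2_eq_square field_simps)

text \<open>Three vectors in the plane are dependent, so their Gram determinant vanishes. Conversely
  a nonzero diagonal entry can be split off; the obstacle is the case of three isotropic
  vectors.\<close>

lemma gram_vectors_iff_det3: "gram_vectors p q r a b c \<longleftrightarrow> det3 p q r a b c = 0"
proof
  assume "gram_vectors p q r a b c"
  then obtain u1 u2 v1 v2 w1 w2 where *: "p = u1\<^sup>2 + u2\<^sup>2" "q = v1\<^sup>2 + v2\<^sup>2" "r = w1\<^sup>2 + w2\<^sup>2"
     "a = u1 * v1 + u2 * v2" "b = u1 * w1 + u2 * w2" "c = v1 * w1 + v2 * w2"
    unfolding gram_vectors_def by metis
  show "det3 p q r a b c = 0" unfolding * det3_def by algebra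
next
  assume d: "det3 p q r a b c = 0"
  consider "p \<noteq> 0" | "q \<noteq> 0" | "r \<noteq> 0" | "p = 0" "q = 0" "r = 0" by blast
  then show "gram_vectors p q r a b c"
  proof cases
    case 1 then show ?thesis using d gram_vectors_nonisotropic by blast
  next
    case 2 then show ?thesis using d gram_vectors_nonisotropic[of q p r a c b] det3_swap gram_vectors_swap12 by metis
  next
    case 3
    then have "gram_vectors r p q b c a"
      using d by (intro gram_vectors_nonisotropic) (simp_all add: det3_def algebra_simps)
    then show ?thesis using gram_vectors_swap12 gram_vectors_swap23 by blast
  next
    case 4
    \<comment> \<open>With zero diagonal the determinant is \<open>2 * a * b * c\<close>.\<close>
    then have "a = 0 \<or> b = 0 \<or> c = 0" using d by (auto simp: det3_def)
    then show ?thesis using 4 gram_vectors_isotropic gram_vectors_swap12 gram_vectors_swap23 by metis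
  qed
qed

text \<open>Taking vertex 0 as the origin leaves three vectors; polarization expresses their mutual
  products through squared edge lengths.\<close>

lemma M24_iff_det3:
  "y \<in> M24 \<longleftrightarrow> det3 (y $ E01) (y $ E02) (y $ E03) ((y $ E01 + y $ E02 - y $ E12) / 2)
     ((y $ E01 + y $ E03 - y $ E13) / 2) ((y $ E02 + y $ E03 - y $ E23) / 2) = 0"
proof
  assume "y \<in> M24"
  then obtain p where p: "y = mmap p" unfolding M24_def by blast
  show "det3 (y $ E01) (y $ E02) (y $ E03) ((y $ E01 + y $ E02 - y $ E12) / 2)
     ((y $ E01 + y $ E03 - y $ E13) / 2) ((y $ E02 + y $ E03 - y $ E23) / 2) = 0"
    unfolding gram_vectors_iff_det3[symmetric] gram_vectors_def
    apply (rule exI[of _ "p 1 $ 1 - p 0 $ 1"], rule exI[of _ "p 1 $ 2 - p 0 $ 2"],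
       rule exI[of _ "p 2 $ 1 - p 0 $ 1"], rule exI[of _ "p 2 $ 2 - p 0 $ 2"],
       rule exI[of _ "p 3 $ 1 - p 0 $ 1"], rule exI[of _ "p 3 $ 2 - p 0 $ 2"])
    by (simp add: p mmap_def sum_2 power2_eq_square algebra_simps)
next
  assume "det3 (y $ E01) (y $ E02) (y $ E03) ((y $ E01 + y $ E02 - y $ E12) / 2)
     ((y $ E01 + y $ E03 - y $ E13) / 2) ((y $ E02 + y $ E03 - y $ E23) / 2) = 0"
  then obtain u1 u2 v1 v2 w1 w2 where *: "u1\<^sup>2 + u2\<^sup>2 = y $ E01" "v1\<^sup>2 + v2\<^sup>2 = y $ E02"
     "w1\<^sup>2 + w2\<^sup>2 = y $ E03" "u1 * v1 + u2 * v2 = (y $ E01 + y $ E02 - y $ E12) / 2"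
     "u1 * w1 + u2 * w2 = (y $ E01 + y $ E03 - y $ E13) / 2"
     "v1 * w1 + v2 * w2 = (y $ E02 + y $ E03 - y $ E23) / 2"
    unfolding gram_vectors_iff_det3[symmetric] gram_vectors_def by blast
  have **: "y $ E12 = (u1 - v1)\<^sup>2 + (u2 - v2)\<^sup>2" "y $ E13 = (u1 - w1)\<^sup>2 + (u2 - w2)\<^sup>2"
     "y $ E23 = (v1 - w1)\<^sup>2 + (v2 - w2)\<^sup>2"
    using * by (simp_all add: field_simps power2_eq_square)
  define p :: "nat \<Rightarrow> complex^2" where
    "p = (\<lambda>n. vector (if n = 0 then [0, 0] else if n = 1 then [u1, u2] else if n = 2 then [v1, v2] else [w1, w2]))"
  have "y = mmap p"
    unfolding vec_eq_iff all_edge using * **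
    by (simp add: mmap_def sum_2 p_def vector_2)
  then show "y \<in> M24" unfolding M24_def by blast
qed

section \<open>Sums and differences of opposite edges\<close>

fun opp :: "edge \<Rightarrow> edge" where
  "opp E01 = E23" | "opp E02 = E13" | "opp E03 = E12"
| "opp E12 = E03" | "opp E13 = E02" | "opp E23 = E01"

text \<open>The positive diagonal entries sit on the edges of a triangle. Putting them on the edges of a star
  instead would change the sign of the product in the sextic below.\<close>
definition Bmat :: "complex ^ edge ^ edge" where
  "Bmat = (\<chi> e f. if f = e then (if e \<in> {E12, E13, E23} then 1 else -1) else if f = opp e then 1 else 0)"

lemma Bmat_mult_vec:
  "(Bmat *v x) $ E01 = x $ E23 - x $ E01" "(Bmat *v x) $ E23 = x $ E23 + x $ E01"
  "(Bmat *v x) $ E02 = x $ E13 - x $ E02" "(Bmat *v x) $ E13 = x $ E13 + x $ E02"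
  "(Bmat *v x) $ E03 = x $ E12 - x $ E03" "(Bmat *v x) $ E12 = x $ E12 + x $ E03"
  by (simp_all add: Bmat_def matrix_vector_mult_def sum_edge)

lemma Bmat_squared: "Bmat ** Bmat = mat 2"
  unfolding vec_eq_iff all_edge by (simp add: Bmat_def matrix_matrix_mult_def sum_edge mat_def)

text \<open>Defined over any commutative ring so that it can be evaluated at linear polynomials,
  which gives its restriction to a line.\<close>

definition sextic :: "(edge \<Rightarrow> 'a::comm_ring_1) \<Rightarrow> 'a" where
  "sextic x = (\<Sum>e\<in>UNIV. x e ^ 2) ^ 3 - 6 * (\<Sum>e\<in>UNIV. x e ^ 2) * (\<Sum>e\<in>UNIV. x e ^ 4)
     + 8 * (\<Sum>e\<in>UNIV. x e ^ 6) + 48 * (\<Prod>e\<in>UNIV. x e)"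

lemma L24_iff_sextic: "v \<in> L24 \<longleftrightarrow> sextic (\<lambda>e. (Bmat *v v) $ e) = 0"
proof -
  define a b c d e f where "a = v $ E01" and "b = v $ E02" and "c = v $ E03"
    and "d = v $ E12" and "e = v $ E13" and "f = v $ E23"
  have "v \<in> L24 \<longleftrightarrow> det3 (a^2) (b^2) (c^2) ((a^2+b^2-d^2)/2) ((a^2+c^2-e^2)/2) ((b^2+c^2-f^2)/2) = 0"
    unfolding L24_def vimage_def mem_Collect_eq M24_iff_det3 by (simp add: sqmap_def a_def b_def c_def d_def e_def f_def)
  moreover have "sextic (\<lambda>e. (Bmat *v v) $ e) = - 384 * det3 (a^2) (b^2) (c^2) ((a^2+b^2-d^2)/2) ((a^2+c^2-e^2)/2) ((b^2+c^2-f^2)/2)"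
    unfolding sextic_def sum_edge prod_edge Bmat_mult_vec a_def[symmetric] b_def[symmetric] c_def[symmetric]
        d_def[symmetric] e_def[symmetric] f_def[symmetric] det3_def
    by (simp add: field_simps) algebra
  ultimately show ?thesis by simp
qed

section \<open>Automorphisms scale the sextic\<close>

definition line_poly :: "(edge \<Rightarrow> complex) \<Rightarrow> (edge \<Rightarrow> complex) \<Rightarrow> complex poly" where
  "line_poly v w = sextic (\<lambda>e. [:v e, w e:])"

lemma poly_line_poly: "poly (line_poly v w) t = sextic (\<lambda>e. v e + t * w e)"
  by (simp add: line_poly_def sextic_def poly_sum poly_prod)

text \<open>Tracks the coefficient at a degree bound rather than the leading coefficient, so that
  sums and products need no case distinction when that coefficient vanishes.\<close>

definition top_coeff :: "nat \<Rightarrow> complex poly \<Rightarrow> complex \<Rightarrow> bool" where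
  "top_coeff n p c \<longleftrightarrow> degree p \<le> n \<and> coeff p n = c"

lemma top_coeff_linear: "top_coeff 1 [:a, b:] b"
  by (simp add: top_coeff_def)

lemma top_coeff_numeral: "top_coeff 0 (numeral k) (numeral k)"
  by (simp add: top_coeff_def numeral_poly)

lemma top_coeff_add: "top_coeff n p c \<Longrightarrow> top_coeff n q d \<Longrightarrow> top_coeff n (p + q) (c + d)"
  by (simp add: top_coeff_def degree_add_le)

lemma top_coeff_diff: "top_coeff n p c \<Longrightarrow> top_coeff n q d \<Longrightarrow> top_coeff n (p - q) (c - d)"
  by (simp add: top_coeff_def degree_diff_le)

lemma top_coeff_mult:
  assumes "top_coeff m p c" "top_coeff n q d"
  shows "top_coeff (m + n) (p * q) (c * d)"
proof -
  have "coeff (p * q) (m + n) = (\<Sum>i\<le>m + n. if i = m then coeff p m * coeff q n else 0)"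
    unfolding coeff_mult
  proof (rule sum.cong)
    fix i assume "i \<in> {..m + n}"
    have "coeff p i * coeff q (m + n - i) = 0" if "i < m"
    proof -
      have "degree q < m + n - i" using assms that by (auto simp: top_coeff_def)
      then show ?thesis by (simp add: coeff_eq_0)
    qed
    moreover have "coeff p i * coeff q (m + n - i) = 0" if "i > m"
      using assms that by (simp add: top_coeff_def coeff_eq_0)
    ultimately show "coeff p i * coeff q (m + n - i) = (if i = m then coeff p m * coeff q n else 0)"
      by (cases i m rule: linorder_cases) auto
  qed simp
  then show ?thesis
    using assms degree_mult_le[of p q] by (auto simp: top_coeff_def)
qed

lemma top_coeff_power: "top_coeff n p c \<Longrightarrow> top_coeff (k * n) (p ^ k) (c ^ k)"
proof (induction k)
  case 0
  show ?case by (simp add: top_coeff_def)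
next
  case (Suc k)
  then show ?case using top_coeff_mult[of n p c "k * n" "p ^ k" "c ^ k"] by simp
qed

lemma top_coeff_sum: "(\<And>i. i \<in> S \<Longrightarrow> top_coeff n (p i) (c i)) \<Longrightarrow> top_coeff n (\<Sum>i\<in>S. p i) (\<Sum>i\<in>S. c i)"
  by (induction S rule: infinite_finite_induct) (auto intro: top_coeff_add simp: top_coeff_def[of n 0])

lemma top_coeff_prod:
  "finite S \<Longrightarrow> (\<And>i. i \<in> S \<Longrightarrow> top_coeff 1 (p i) (c i)) \<Longrightarrow> top_coeff (card S) (\<Prod>i\<in>S. p i) (\<Prod>i\<in>S. c i)"
proof (induction S rule: finite_induct)
  case empty
  show ?case by (simp add: top_coeff_def)
next
  case (insert x S)
  then show ?case using top_coeff_mult[of 1 "p x" "c x" "card S" "\<Prod>i\<in>S. p i" "\<Prod>i\<in>S. c i"] by simp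
qed

lemma card_edge: "CARD(edge) = 6"
  by (simp add: edge_UNIV)

text \<open>By homogeneity the coefficient of \<open>t^6\<close> depends on the direction alone.
  Moving the base point thus leaves degree and leading coefficient unchanged whenever
  \<open>sextic w\<close> is nonzero.\<close>

lemma top_coeff_line_poly: "top_coeff 6 (line_poly v w) (sextic w)"
proof -
  have pow: "top_coeff k (\<Sum>e\<in>UNIV. [:v e, w e:] ^ k) (\<Sum>e\<in>UNIV. w e ^ k)" for k
    using top_coeff_power[OF top_coeff_linear, of k] by (intro top_coeff_sum) simp
  have 1: "top_coeff 6 ((\<Sum>e\<in>UNIV. [:v e, w e:] ^ 2) ^ 3) ((\<Sum>e\<in>UNIV. w e ^ 2) ^ 3)"
    using top_coeff_power[OF pow[of 2], of 3] by simp
  \<comment> \<open>The \<open>num\<close> terms in this and the next steps spell out the numerals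
    6, 8 and 48.\<close>
  have 2: "top_coeff 6 (6 * (\<Sum>e\<in>UNIV. [:v e, w e:] ^ 2) * (\<Sum>e\<in>UNIV. [:v e, w e:] ^ 4))
      (6 * (\<Sum>e\<in>UNIV. w e ^ 2) * (\<Sum>e\<in>UNIV. w e ^ 4))"
    using top_coeff_mult[OF top_coeff_mult[OF top_coeff_numeral[of "num.Bit0 (num.Bit1 num.One)"] pow[of 2]] pow[of 4]] by simp
  have 3: "top_coeff 6 (8 * (\<Sum>e\<in>UNIV. [:v e, w e:] ^ 6)) (8 * (\<Sum>e\<in>UNIV. w e ^ 6))"
    using top_coeff_mult[OF top_coeff_numeral[of "num.Bit0 (num.Bit0 (num.Bit0 num.One))"] pow[of 6]] by simp
  have "top_coeff 6 (\<Prod>e\<in>UNIV. [:v e, w e:]) (\<Prod>e\<in>UNIV. w e)"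
    using top_coeff_prod[OF finite_class.finite_UNIV top_coeff_linear, of v w, unfolded card_edge] .
  from top_coeff_mult[OF top_coeff_numeral[of "num.Bit0 (num.Bit0 (num.Bit0 (num.Bit0 (num.Bit1 num.One))))"] this]
  have 4: "top_coeff 6 (48 * (\<Prod>e\<in>UNIV. [:v e, w e:])) (48 * (\<Prod>e\<in>UNIV. w e))" by simp
  show ?thesis unfolding line_poly_def sextic_def
    by (intro top_coeff_add top_coeff_diff 1 2 3 4)
qed

section \<open>Stability of distinct roots\<close>

lemma root_near_small_value:
  fixes p :: "complex poly"
  assumes "\<delta> > 0" and small: "norm (poly p t) < norm (lead_coeff p) * \<delta> ^ degree p"
  obtains r where "poly p r = 0" "dist r t < \<delta>"
proof -
  have p0: "p \<noteq> 0" using small by auto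
  then obtain A where A: "size A = degree p" "p = smult (lead_coeff p) (\<Prod>x\<in>#A. [:-x, 1:])"
    using alg_closed_imp_factorization by metis
  have "\<exists>r. poly p r = 0 \<and> dist r t < \<delta>"
  proof (rule ccontr)
    assume "\<not> ?thesis"
    then have far: "poly p r = 0 \<Longrightarrow> dist r t \<ge> \<delta>" for r by force
    have root: "poly p r = 0" if "r \<in># A" for r
    proof -
      have "poly (\<Prod>x\<in>#A. [:-x, 1:]) r = 0"
        using that by (auto simp: poly_prod_mset prod_mset_zero_iff)
      then show ?thesis by (subst A(2)) simp
    qed
    \<comment> \<open>If every root is at distance at least \<delta> from \<open>t\<close>, each
      linear factor has norm at least \<delta>. Induction over sub-multisets of the roots respects
      multiplicities.\<close>
    have "norm (poly (\<Prod>x\<in>#C. [:-x, 1:]) t) \<ge> \<delta> ^ size C" if "C \<subseteq># A" for C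
      using that
    proof (induction C)
      case empty
      show ?case by simp
    next
      case (add x C)
      have "x \<in># A" using add.prems by (meson mset_subset_eq_insertD)
      then have "norm (t - x) \<ge> \<delta>" using far root by (metis dist_norm dist_commute)
      moreover have "norm (poly (\<Prod>x\<in>#C. [:-x, 1:]) t) \<ge> \<delta> ^ size C"
        using add by (meson mset_subset_eq_insertD subset_mset.less_imp_le)
      ultimately have "\<delta> * \<delta> ^ size C \<le> norm (t - x) * norm (poly (\<Prod>x\<in>#C. [:-x, 1:]) t)"
        using \<open>\<delta> > 0\<close> by (intro mult_mono) auto
      then show ?case by (simp add: norm_mult[symmetric] algebra_simps)
    qed
    from this[of A] have "\<delta> ^ degree p \<le> norm (poly (\<Prod>x\<in>#A. [:-x, 1:]) t)" using A by simp
    then have "norm (lead_coeff p) * \<delta> ^ degree p \<le> norm (poly p t)"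
      by (subst (3) A(2)) (simp add: norm_mult mult_left_mono)
    then show False using small by simp
  qed
  then show ?thesis using that by blast
qed


text \<open>Constant degree and leading coefficient make the threshold of
  \<open>root_near_small_value\<close> independent of \<open>s\<close>. Balls of radius at most half
  the least distance in \<open>T\<close> keep the new roots apart, so their number cannot drop.
  Continuity is needed only at each fixed \<open>t\<close>.\<close>

lemma distinct_roots_perturbation:
  fixes p :: "complex \<Rightarrow> complex poly"
  assumes deg: "\<And>s. degree (p s) = n" and lc: "\<And>s. coeff (p s) n = c" and "c \<noteq> 0"
    and cont: "\<And>t. isCont (\<lambda>s. poly (p s) t) 0"
    and T: "finite T" "\<And>t. t \<in> T \<Longrightarrow> poly (p 0) t = 0"
  shows "\<forall>\<^sub>F s in at 0. card T \<le> card {t. poly (p s) t = 0}"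
proof -
  obtain \<delta> where \<delta>: "\<delta> > 0" "\<And>t u. t \<in> T \<Longrightarrow> u \<in> T \<Longrightarrow> t \<noteq> u \<Longrightarrow> 2 * \<delta> \<le> dist t u"
  proof (cases "T = {}")
    case True
    then show ?thesis using that[of 1] by simp
  next
    case False
    \<comment> \<open>The extra element \<open>1\<close> keeps \<open>D\<close> nonempty when
      \<open>T\<close> has a single point.\<close>
    define D where "D = insert 1 ((\<lambda>(t, u). dist t u) ` {(t, u) \<in> T \<times> T. t \<noteq> u})"
    have fin: "finite D" unfolding D_def using T(1) by (auto intro: finite_subset[of _ "T \<times> T"])
    have "Min D > 0" using fin by (subst Min_gr_iff) (auto simp: D_def)
    moreover have "Min D \<le> dist t u" if "t \<in> T" "u \<in> T" "t \<noteq> u" for t u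
      using fin that by (intro Min_le) (auto simp: D_def)
    ultimately show ?thesis using that[of "Min D / 2"] by simp
  qed
  have "\<forall>\<^sub>F s in at 0. norm (poly (p s) t) < norm c * \<delta> ^ n" if "t \<in> T" for t
  proof -
    have "((\<lambda>s. norm (poly (p s) t)) \<longlongrightarrow> 0) (at 0)"
      using cont[of t] T(2)[OF that] by (simp add: isCont_def tendsto_norm_zero)
    then show ?thesis using \<open>c \<noteq> 0\<close> \<delta>(1) by (intro order_tendstoD(2)) auto
  qed
  then have "\<forall>\<^sub>F s in at 0. \<forall>t\<in>T. norm (poly (p s) t) < norm c * \<delta> ^ n"
    using T(1) by (simp add: eventually_ball_finite)
  then show ?thesis
  proof eventually_elim
    case (elim s)
    have "\<exists>r. poly (p s) r = 0 \<and> dist r t < \<delta>" if "t \<in> T" for t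
      using elim that deg lc \<delta>(1) root_near_small_value[of \<delta> "p s" t] by metis
    then obtain r where r: "\<And>t. t \<in> T \<Longrightarrow> poly (p s) (r t) = 0 \<and> dist (r t) t < \<delta>" by metis
    have "inj_on r T"
    proof (rule inj_onI, rule ccontr)
      fix t u assume "t \<in> T" "u \<in> T" "r t = r u" "t \<noteq> u"
      then show False using r[of t] r[of u] \<delta>(2)[of t u] dist_triangle3[of t u "r t"] by auto
    qed
    moreover have "p s \<noteq> 0" using lc[of s] \<open>c \<noteq> 0\<close> by auto
    ultimately show ?case using r by (intro card_inj_on_le[of r]) (auto intro: poly_roots_finite)
  qed
qed

text \<open>The same two-parameter family read as a polynomial in either parameter; this supplies
  the continuity in \<open>s\<close>.\<close>

lemma line_poly_swap: "poly (line_poly (\<lambda>e. v e + s * u e) w) t = poly (line_poly (\<lambda>e. v e + t * w e) u) s"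
  by (simp add: poly_line_poly add_ac)

lemma poly_eq_if_equal_near_0:
  fixes p q :: "complex poly"
  assumes "\<forall>\<^sub>F s in at 0. poly p s = poly q s"
  shows "p = q"
proof (rule ccontr)
  assume "p \<noteq> q"
  then have "finite {s. poly (p - q) s = 0}" by (intro poly_roots_finite) simp
  then have "\<forall>\<^sub>F s in at 0. s \<notin> {s. poly (p - q) s = 0}"
    using islimpt_finite islimpt_iff_eventually by blast
  with assms have "\<forall>\<^sub>F s::complex in at 0. False" by eventually_elim auto
  then show False by simp
qed

lemma sextic_proportional:
  fixes M :: "complex ^ edge ^ edge"
  assumes pres: "\<And>x. sextic (\<lambda>e. (M *v x) $ e) = 0 \<longleftrightarrow> sextic (\<lambda>e. x $ e) = 0"
  obtains c where "c \<noteq> 0" "\<And>x. sextic (\<lambda>e. (M *v x) $ e) = c * sextic (\<lambda>e. x $ e)"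
proof -
  \<comment> \<open>The two fixed squares 5 and 4 are chosen so that, with \<open>t\<close> as third
    coordinate, the restricted sextic has the factors \<open>t^2 + 1\<close>, \<open>t^2 - 1\<close>
    and \<open>t^2 - 9\<close>, hence six distinct explicit roots.\<close>
  obtain z :: complex where z: "z\<^sup>2 = 5" using power2_csqrt by blast
  define w :: "complex ^ edge" where "w = axis E01 1"
  define v :: "complex ^ edge" where "v = (\<chi> e. if e = E02 then z else if e = E03 then 2 else 0)"
  have s4: "z ^ 4 = 25" "z ^ 6 = 125"
    using power_mult[of z 2 2] power_mult[of z 2 3] z by simp_all
  have sw: "sextic (\<lambda>e. w $ e) = 3"
    by (simp add: sextic_def w_def axis_def sum_edge prod_edge)
  have Mlin: "(\<lambda>e. (M *v (x + t *s y)) $ e) = (\<lambda>e. (M *v x) $ e + t * (M *v y) $ e)" for x y t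
    by (simp add: matrix_vector_right_distrib vector_scalar_commute fun_eq_iff)
  have lin: "(\<lambda>e. (x + t *s y) $ e) = (\<lambda>e. x $ e + t * y $ e)" for x y :: "complex ^ edge" and t
    by simp
  have "sextic (\<lambda>e. (M *v w) $ e) * sextic (\<lambda>e. x $ e) = 3 * sextic (\<lambda>e. (M *v x) $ e)" for x
  proof -
    \<comment> \<open>The base point \<open>v + s *s u\<close> runs from \<open>v\<close> at
      \<open>s = 0\<close>, where the roots are known, to the given \<open>x\<close> at
      \<open>s = 1\<close>.\<close>
    define u where "u = x - v"
    define p where "p s = line_poly (\<lambda>e. (v + s *s u) $ e) (\<lambda>e. w $ e)" for s
    define q where "q s = line_poly (\<lambda>e. (M *v (v + s *s u)) $ e) (\<lambda>e. (M *v w) $ e)" for s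
    have tp: "top_coeff 6 (p s) 3" for s using top_coeff_line_poly[of _ "\<lambda>e. w $ e"] by (simp add: p_def sw)
    have tq: "top_coeff 6 (q s) (sextic (\<lambda>e. (M *v w) $ e))" for s
      using top_coeff_line_poly by (simp add: q_def)
    have degp: "degree (p s) = 6" for s using tp[of s] le_degree[of "p s" 6] by (simp add: top_coeff_def)
    \<comment> \<open>On three coordinates the sextic splits: with \<open>A, B, C\<close> the squares of the coordinates it is
      \<open>-3 (A + B - C) (A - B + C) (B + C - A)\<close>.\<close>
    have p0: "poly (p 0) t = 3 * (t\<^sup>2 - 9) * (t\<^sup>2 - 1) * (t\<^sup>2 + 1)" for t
    proof -
      have "poly (p 0) t = (t\<^sup>2 + 9) ^ 3 - 6 * (t\<^sup>2 + 9) * (t ^ 4 + 41) + 8 * (t ^ 6 + 189)"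
        by (simp add: p_def poly_line_poly sextic_def sum_edge prod_edge v_def w_def axis_def z s4 add.commute)
      also have "\<dots> = 3 * (t\<^sup>2 - 9) * (t\<^sup>2 - 1) * (t\<^sup>2 + 1)" by algebra
      finally show ?thesis .
    qed
    have "\<forall>\<^sub>F s in at 0. card {3, -3, 1, -1, \<i>, -\<i>} \<le> card {t. poly (p s) t = 0}"
    proof (rule distinct_roots_perturbation[where p = p and n = 6 and c = 3])
      fix t
      have "(\<lambda>s. poly (p s) t) = (\<lambda>s. poly (line_poly (\<lambda>e. v $ e + t * w $ e) (\<lambda>e. u $ e)) s)"
        unfolding p_def lin by (rule ext, rule line_poly_swap)
      then show "isCont (\<lambda>s. poly (p s) t) 0" by (simp add: poly_isCont)
    qed (use tp degp p0 in \<open>auto simp: top_coeff_def\<close>)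
    moreover have "card {3, -3, 1, -1, \<i>, -\<i>} = 6"
      by (simp add: complex_eq_iff)
    ultimately have "\<forall>\<^sub>F s in at 0. 6 \<le> card {t. poly (p s) t = 0}" by simp
    then have "\<forall>\<^sub>F s in at 0. smult (sextic (\<lambda>e. (M *v w) $ e)) (p s) = smult 3 (q s)"
    proof eventually_elim
      case (elim s)
      \<comment> \<open>The multipliers cancel the terms in \<open>t^6\<close>, so \<open>r\<close>
        has degree below six while vanishing at the six roots of \<open>p s\<close>.\<close>
      define r where "r = smult (sextic (\<lambda>e. (M *v w) $ e)) (p s) - smult 3 (q s)"
      have "top_coeff 6 r 0"
        using tp[of s] tq[of s] by (auto simp: r_def top_coeff_def intro: degree_diff_le)
      have "r = 0"
      proof (rule ccontr)
        assume "r \<noteq> 0"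
        then have "degree r < 6"
          using \<open>top_coeff 6 r 0\<close> by (metis top_coeff_def le_neq_implies_less leading_coeff_0_iff)
        have "{t. poly (p s) t = 0} \<subseteq> {t. poly r t = 0}"
        proof safe
          fix t assume t: "poly (p s) t = 0"
          have "poly (p s) t = sextic (\<lambda>e. ((v + s *s u) + t *s w) $ e)"
            unfolding p_def poly_line_poly by (simp only: lin)
          moreover have "poly (q s) t = sextic (\<lambda>e. (M *v ((v + s *s u) + t *s w)) $ e)"
            unfolding q_def poly_line_poly by (simp only: Mlin)
          ultimately have "poly (q s) t = 0" using pres t by metis
          then show "poly r t = 0" using t by (simp add: r_def)
        qed
        then have "card {t. poly (p s) t = 0} \<le> card {t. poly r t = 0}"
          using \<open>r \<noteq> 0\<close> by (intro card_mono poly_roots_finite)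
        then show False
          using elim card_poly_roots_bound[OF \<open>r \<noteq> 0\<close>] \<open>degree r < 6\<close> by simp
      qed
      then show ?case by (simp add: r_def)
    qed
    \<comment> \<open>Setting \<open>t = 0\<close> leaves an identity between two polynomials in
      \<open>s\<close>, which extends from a punctured neighbourhood of 0 to
      \<open>s = 1\<close>.\<close>
    then have "\<forall>\<^sub>F s in at 0. poly (smult (sextic (\<lambda>e. (M *v w) $ e)) (line_poly (\<lambda>e. v $ e) (\<lambda>e. u $ e))) s
        = poly (smult 3 (line_poly (\<lambda>e. (M *v v) $ e) (\<lambda>e. (M *v u) $ e))) s"
    proof eventually_elim
      case (elim s)
      then have "poly (smult (sextic (\<lambda>e. (M *v w) $ e)) (p s)) 0 = poly (smult 3 (q s)) 0" by simp
      then show ?case by (simp add: p_def q_def poly_line_poly Mlin lin)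
    qed
    then have "smult (sextic (\<lambda>e. (M *v w) $ e)) (line_poly (\<lambda>e. v $ e) (\<lambda>e. u $ e))
        = smult 3 (line_poly (\<lambda>e. (M *v v) $ e) (\<lambda>e. (M *v u) $ e))"
      by (rule poly_eq_if_equal_near_0)
    then have "poly (smult (sextic (\<lambda>e. (M *v w) $ e)) (line_poly (\<lambda>e. v $ e) (\<lambda>e. u $ e))) 1
        = poly (smult 3 (line_poly (\<lambda>e. (M *v v) $ e) (\<lambda>e. (M *v u) $ e))) 1" by simp
    then show ?thesis
      unfolding poly_smult poly_line_poly lin[symmetric] Mlin[symmetric]
      by (simp add: u_def flip: matrix_vector_right_distrib)
  qed
  moreover have "sextic (\<lambda>e. (M *v w) $ e) \<noteq> 0" using pres[of w] sw by simp
  ultimately show ?thesis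
    by (intro that[of "sextic (\<lambda>e. (M *v w) $ e) / 3"]) (simp_all add: field_simps)
qed

section \<open>Triple points\<close>

text \<open>Vanishing to order at least three, tested on all lines through the point so that no
  partial derivatives are needed. The origin qualifies as well.\<close>

definition triple_point :: "(edge \<Rightarrow> complex) \<Rightarrow> bool" where
  "triple_point x \<longleftrightarrow> (\<forall>w. \<forall>k<3. coeff (line_poly x w) k = 0)"

text \<open>Surjectivity of \<open>M\<close> makes every line through the image the image of a line
  through \<open>x\<close>, and the two restrictions differ by the constant
  \<open>c\<close>.\<close>

lemma triple_point_image:
  fixes M :: "complex ^ edge ^ edge"
  assumes "\<And>x. sextic (\<lambda>e. (M *v x) $ e) = c * sextic (\<lambda>e. x $ e)" and "invertible M"
    and "triple_point (\<lambda>e. x $ e)"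
  shows "triple_point (\<lambda>e. (M *v x) $ e)"
  unfolding triple_point_def
proof (intro allI impI)
  fix w' :: "edge \<Rightarrow> complex" and k :: nat assume "k < 3"
  obtain w where w: "M *v w = (\<chi> e. w' e)"
    using \<open>invertible M\<close> by (metis invertible_def matrix_vector_mul_assoc matrix_vector_mul_lid)
  have "line_poly (\<lambda>e. (M *v x) $ e) w' = smult c (line_poly (\<lambda>e. x $ e) (\<lambda>e. w $ e))"
  proof -
    have "poly (line_poly (\<lambda>e. (M *v x) $ e) w') t = poly (smult c (line_poly (\<lambda>e. x $ e) (\<lambda>e. w $ e))) t" for t
    proof -
      have "(\<lambda>e. (M *v x) $ e + t * w' e) = (\<lambda>e. (M *v (x + t *s w)) $ e)"
        using w by (simp add: matrix_vector_right_distrib vector_scalar_commute fun_eq_iff)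
      then show ?thesis by (simp add: poly_line_poly assms(1))
    qed
    then show ?thesis by (simp flip: poly_eq_poly_eq_iff add: fun_eq_iff)
  qed
  then show "coeff (line_poly (\<lambda>e. (M *v x) $ e) w') k = 0"
    using assms(3) \<open>k < 3\<close> by (simp add: triple_point_def)
qed

section \<open>Taylor coefficients up to second order\<close>

lemma coeff_mult_low:
  fixes p q :: "'a::comm_ring_1 poly"
  shows "coeff (p * q) 0 = coeff p 0 * coeff q 0"
    "coeff (p * q) (Suc 0) = coeff p 0 * coeff q (Suc 0) + coeff p (Suc 0) * coeff q 0"
    "coeff (p * q) 2 = coeff p 0 * coeff q 2 + coeff p (Suc 0) * coeff q (Suc 0) + coeff p 2 * coeff q 0"
  by (simp_all add: coeff_mult numeral_2_eq_2)

lemma coeff_linear_power_low: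
  fixes a b :: "'a::comm_ring_1"
  assumes "n \<ge> 2"
  shows "coeff ([:a, b:] ^ n) 0 = a ^ n"
    "coeff ([:a, b:] ^ n) (Suc 0) = of_nat n * a ^ (n - 1) * b"
    "coeff ([:a, b:] ^ n) 2 = of_nat (n choose 2) * a ^ (n - 2) * b\<^sup>2"
  using assms by (simp_all add: coeff_linear_poly_power mult_ac)

text \<open>Half the Hessian form of the sextic at \<open>x\<close>, evaluated at \<open>w\<close>.
  The contribution of the product stays unexpanded because it is needed only in directions with one
  or two nonzero coordinates.\<close>

lemma coeff_line_poly_2:
  "coeff (line_poly x w) 2 = (
     3 * (\<Sum>e\<in>UNIV. x e ^ 2)\<^sup>2 * (\<Sum>e\<in>UNIV. w e ^ 2) + 12 * (\<Sum>e\<in>UNIV. x e ^ 2) * (\<Sum>e\<in>UNIV. x e * w e)\<^sup>2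
     - 36 * (\<Sum>e\<in>UNIV. x e ^ 2) * (\<Sum>e\<in>UNIV. x e ^ 2 * w e ^ 2)
     - 48 * (\<Sum>e\<in>UNIV. x e * w e) * (\<Sum>e\<in>UNIV. x e ^ 3 * w e)
     - 6 * (\<Sum>e\<in>UNIV. w e ^ 2) * (\<Sum>e\<in>UNIV. x e ^ 4)
     + 120 * (\<Sum>e\<in>UNIV. x e ^ 4 * w e ^ 2) + 48 * coeff (\<Prod>e\<in>UNIV. [:x e, w e:]) 2)" (is "_ = ?rhs")
proof -
  define P where "P k = (\<Sum>e\<in>UNIV. [:x e, w e:] ^ k)" for k
  define Q where "Q = (\<Prod>e\<in>UNIV. [:x e, w e:])"
  have b: "(4::nat) choose 2 = 6" "(6::nat) choose 2 = 15" by (simp_all add: numeral_eq_Suc)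
  have P0: "coeff (P k) 0 = (\<Sum>e\<in>UNIV. x e ^ k)" if "k \<ge> 2" for k
    using that by (simp add: P_def coeff_sum coeff_linear_power_low)
  have P1: "coeff (P k) (Suc 0) = of_nat k * (\<Sum>e\<in>UNIV. x e ^ (k - 1) * w e)" if "k \<ge> 2" for k
    using that by (simp add: P_def coeff_sum coeff_linear_power_low sum_distrib_left mult.assoc)
  have P2: "coeff (P k) 2 = of_nat (k choose 2) * (\<Sum>e\<in>UNIV. x e ^ (k - 2) * w e ^ 2)" if "k \<ge> 2" for k
    using that by (simp add: P_def coeff_sum coeff_linear_power_low sum_distrib_left mult.assoc)
  have "line_poly x w = P 2 * P 2 * P 2 - smult 6 (P 2 * P 4) + smult 8 (P 6) + smult 48 Q"
    unfolding line_poly_def sextic_def P_def[symmetric] Q_def[symmetric]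
    by (simp add: numeral_poly power3_eq_cube)
  then have "coeff (line_poly x w) 2 = coeff (P 2 * P 2 * P 2) 2 - 6 * coeff (P 2 * P 4) 2 + 8 * coeff (P 6) 2 + 48 * coeff Q 2"
    by simp
  also have "\<dots> = 3 * (coeff (P 2) 0)\<^sup>2 * coeff (P 2) 2 + 3 * coeff (P 2) 0 * (coeff (P 2) (Suc 0))\<^sup>2
      - 6 * (coeff (P 2) 0 * coeff (P 4) 2 + coeff (P 2) (Suc 0) * coeff (P 4) (Suc 0) + coeff (P 2) 2 * coeff (P 4) 0)
      + 8 * coeff (P 6) 2 + 48 * coeff Q 2"
    unfolding coeff_mult_low by algebra
  also have "\<dots> = ?rhs"
    unfolding Q_def[symmetric]
    by (simp add: P0 P1 P2 b power2_eq_square algebra_simps)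
  finally show ?thesis .
qed


lemma coeff_prod_linear_indicator1:
  fixes x :: "edge \<Rightarrow> complex"
  shows "coeff (\<Prod>e\<in>UNIV. [:x e, if e = i then 1 else 0:]) 2 = 0"
  by (cases i) (simp_all add: prod_edge coeff_mult_low numeral_2_eq_2)

lemma coeff_prod_linear_indicator2:
  fixes x :: "edge \<Rightarrow> complex"
  assumes "i \<noteq> j"
  shows "coeff (\<Prod>e\<in>UNIV. [:x e, if e = i \<or> e = j then 1 else 0:]) 2 = (\<Prod>e\<in>UNIV - {i, j}. x e)"
  using assms by (cases i; cases j) (simp_all add: prod_edge coeff_mult_low edge_UNIV insert_Diff_if numeral_2_eq_2)

text \<open>The Hessian is evaluated at a unit vector and at a sum of two unit vectors; the mixed
  relation is what remains of the latter once both diagonal relations are subtracted.\<close>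

lemma triple_point_hessian:
  fixes x :: "edge \<Rightarrow> complex"
  assumes "triple_point x"
  defines "p2 \<equiv> \<Sum>e\<in>UNIV. x e ^ 2" and "p4 \<equiv> \<Sum>e\<in>UNIV. x e ^ 4"
  shows diagonal_hessian: "p2\<^sup>2 - 2 * p4 - 8 * p2 * x i ^ 2 + 24 * x i ^ 4 = 0"
    and mixed_hessian: "i \<noteq> j \<Longrightarrow> x i * x j * (p2 - 2 * x i ^ 2 - 2 * x j ^ 2) + 2 * (\<Prod>e\<in>UNIV - {i, j}. x e) = 0"
proof -
  have diag: "p2\<^sup>2 - 2 * p4 - 8 * p2 * x i ^ 2 + 24 * x i ^ 4 = 0" for i
  proof -
    have z: "coeff (line_poly x (\<lambda>e. if e = i then 1 else 0)) 2 = 0"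
      using assms(1) by (simp add: triple_point_def)
    have s1: "(\<Sum>e\<in>UNIV. f e * (if e = i then 1 else 0)) = f i"
      and s2: "(\<Sum>e\<in>UNIV. f e * (if e = i then 1 else 0)\<^sup>2) = f i" for f :: "edge \<Rightarrow> complex"
      by (simp_all add: if_distrib[of "\<lambda>z. z\<^sup>2"] if_distrib[of "\<lambda>z. f _ * z"] cong: if_cong)
    have s0: "(\<Sum>e\<in>UNIV. (if e = i then 1 else 0)\<^sup>2) = (1::complex)"
      using s2[of "\<lambda>_. 1"] by simp
    show ?thesis
      using z unfolding coeff_line_poly_2 coeff_prod_linear_indicator1 s0 s1 s2 p2_def[symmetric] p4_def[symmetric]
      by algebra
  qed
  show "p2\<^sup>2 - 2 * p4 - 8 * p2 * x i ^ 2 + 24 * x i ^ 4 = 0" by (rule diag)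
  assume ij: "i \<noteq> j"
  have z: "coeff (line_poly x (\<lambda>e. if e = i \<or> e = j then 1 else 0)) 2 = 0"
    using assms(1) by (simp add: triple_point_def)
  have s1: "(\<Sum>e\<in>UNIV. f e * (if e = i \<or> e = j then 1 else 0)) = f i + f j" for f :: "edge \<Rightarrow> complex"
    using ij by (subst sum.cong[OF refl, where h = "\<lambda>e. (if e = i then f e else 0) + (if e = j then f e else 0)"])
       (auto simp: sum.distrib)
  have s2: "(\<Sum>e\<in>UNIV. f e * (if e = i \<or> e = j then 1 else 0)\<^sup>2) = f i + f j" for f :: "edge \<Rightarrow> complex"
    using s1[of f] by (simp add: if_distrib[of "\<lambda>z. z\<^sup>2"] cong: if_cong)
  have s0: "(\<Sum>e\<in>UNIV. (if e = i \<or> e = j then 1 else 0)\<^sup>2) = (1 + 1::complex)"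
    using s2[of "\<lambda>_. 1"] by simp
  have "3 * p2\<^sup>2 * (1 + 1) + 12 * p2 * (x i + x j)\<^sup>2 - 36 * p2 * (x i ^ 2 + x j ^ 2)
     - 48 * (x i + x j) * (x i ^ 3 + x j ^ 3) - 6 * (1 + 1) * p4 + 120 * (x i ^ 4 + x j ^ 4)
     + 48 * (\<Prod>e\<in>UNIV - {i, j}. x e) = 0"
    using z unfolding coeff_line_poly_2 coeff_prod_linear_indicator2[OF ij] s0 s1 s2 p2_def[symmetric] p4_def[symmetric] .
  then show "x i * x j * (p2 - 2 * x i ^ 2 - 2 * x j ^ 2) + 2 * (\<Prod>e\<in>UNIV - {i, j}. x e) = 0"
    using diag[of i] diag[of j] by algebra
qed

text \<open>All squares are roots of \<open>24 * y^2 - 8 * p2 * y + p2^2 - 2 * p4\<close>, so only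
  the coexistence of two values has to be excluded. Then \<open>p2 = 6 * y\<close>, and a mixed
  relation becomes the product formula.\<close>

lemma triple_point_imp_equal_squares:
  assumes "triple_point x"
  shows "x i ^ 2 = x j ^ 2" and "(\<Prod>e\<in>UNIV. x e) = - ((x i ^ 2) ^ 3)"
proof -
  define p2 p4 where "p2 = (\<Sum>e\<in>UNIV. x e ^ 2)" and "p4 = (\<Sum>e\<in>UNIV. x e ^ 4)"
  note D = diagonal_hessian[OF assms, folded p2_def p4_def]
  note O = mixed_hessian[OF assms, folded p2_def]
  have all: "(\<forall>i j. x i ^ 2 = x j ^ 2) \<and> (\<forall>i. (\<Prod>e\<in>UNIV. x e) = - ((x i ^ 2) ^ 3))"
  proof (cases "\<exists>k. x k = 0")
    \<comment> \<open>A zero coordinate kills the constant term of the quadratic, so every nonzero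
      square is \<open>p2 / 3\<close>. There would be exactly three of them, whence
      \<open>p4 = p2^2 / 3\<close>, against \<open>p2^2 = 2 * p4\<close>.\<close>
    case True
    then obtain k where k: "x k = 0" by blast
    have K: "p2\<^sup>2 - 2 * p4 = 0" using D[of k] k by simp
    have nz: "3 * x j ^ 2 = p2" if "x j \<noteq> 0" for j
    proof -
      have "x j ^ 2 * (3 * x j ^ 2 - p2) = 0" using D[of j] K by algebra
      then show ?thesis using that by simp
    qed
    have "x j = 0" for j
    proof (rule ccontr)
      assume j: "x j \<noteq> 0"
      define S where "S = {i. x i \<noteq> 0}"
      have sq: "x i ^ 2 = x j ^ 2" if "i \<in> S" for i
      proof -
        have "3 * x i ^ 2 = 3 * x j ^ 2" using nz[of i] nz[OF j] that by (simp add: S_def)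
        then show ?thesis by simp
      qed
      have "p2 = (\<Sum>e\<in>S. x e ^ 2)" unfolding p2_def S_def by (rule sum.mono_neutral_right) auto
      also have "\<dots> = of_nat (card S) * x j ^ 2" using sq by simp
      finally have "of_nat (card S) = (3::complex)" using nz[OF j] j by simp
      have "p4 = (\<Sum>e\<in>S. x e ^ 4)" unfolding p4_def S_def by (rule sum.mono_neutral_right) auto
      also have "\<dots> = (\<Sum>e\<in>S. (x j ^ 2) ^ 2)"
      proof (rule sum.cong[OF refl])
        fix e assume "e \<in> S"
        then show "x e ^ 4 = (x j ^ 2) ^ 2" using sq power_mult[of "x e" 2 2] by simp
      qed
      also have "\<dots> = 3 * (x j ^ 2)^2" using \<open>of_nat (card S) = (3::complex)\<close> by simp
      finally have "(x j ^ 2)^2 = 0" using K nz[OF j] by algebra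
      then show False using j by simp
    qed
    then show ?thesis by (simp add: prod_edge)
  next
    case False
    define P where "P = (\<Prod>e\<in>UNIV. x e)"
    \<comment> \<open>Multiplying the mixed relation by \<open>x i * x j\<close> completes the
      product, so the right-hand side no longer depends on the pair.\<close>
    have N: "x i ^ 2 * x j ^ 2 * (p2 - 2 * x i ^ 2 - 2 * x j ^ 2) = - 2 * P" if "i \<noteq> j" for i j
    proof -
      have "P = x i * (x j * (\<Prod>e\<in>UNIV - {i, j}. x e))"
        unfolding P_def using that by (subst prod.remove[of _ i], simp, simp, subst prod.remove[of _ j])
          (auto simp: Diff_insert2[symmetric] insert_commute)
      then show ?thesis using O[OF that] by algebra
    qed
    have eq: "x j ^ 2 = x k ^ 2" for j k
    proof (rule ccontr)
      assume jk: "x j ^ 2 \<noteq> x k ^ 2"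
      \<comment> \<open>Comparing the pairs \<open>(i, j)\<close> and \<open>(i, k)\<close> forces
        every other square to have this value.\<close>
      define t where "t = p2 / 2 - x j ^ 2 - x k ^ 2"
      have t: "x i ^ 2 = t" if "i \<noteq> j" "i \<noteq> k" for i
      proof -
        have "x i ^ 2 * ((x j ^ 2 - x k ^ 2) * (p2 - 2 * x i ^ 2 - 2 * x j ^ 2 - 2 * x k ^ 2)) = 0"
          using N[OF that(1)] N[OF that(2)] by algebra
        then have "p2 - 2 * x i ^ 2 - 2 * x j ^ 2 - 2 * x k ^ 2 = 0" using False jk by simp
        then show ?thesis unfolding t_def by (simp add: field_simps)
      qed
      have "j \<noteq> k" using jk by auto
      then have "card (UNIV - {j, k}) = 4" by (simp add: card_Diff_subset card_edge)
      have "p2 = x j ^ 2 + (x k ^ 2 + (\<Sum>e\<in>UNIV - {j, k}. x e ^ 2))"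
        unfolding p2_def using \<open>j \<noteq> k\<close> by (subst sum.remove[of _ j], simp, simp, subst sum.remove[of _ k])
          (auto simp: Diff_insert2[symmetric] insert_commute)
      also have "(\<Sum>e\<in>UNIV - {j, k}. x e ^ 2) = 4 * t" using t \<open>card (UNIV - {j, k}) = 4\<close> by simp
      finally have sum: "x j ^ 2 + x k ^ 2 = 2 * t" unfolding t_def by (simp add: field_simps)
      have "UNIV - {j, k} \<noteq> {}" using \<open>card (UNIV - {j, k}) = 4\<close> by force
      then obtain i where i: "i \<noteq> j" "i \<noteq> k" by blast
      have q: "p2\<^sup>2 - 2 * p4 - 8 * p2 * x i ^ 2 + 24 * (x i ^ 2)\<^sup>2 = 0" for i
        using D[of i] by simp
      \<comment> \<open>Here \<open>p2 = 6 * t\<close>, so the roots of the quadratic add up to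
        \<open>2 * t\<close> and \<open>t\<close> is one of them. It is a double root, and both
        squares equal it.\<close>
      have "(x j ^ 2 - x k ^ 2)\<^sup>2 = 0"
        using q[of i] q[of j] q[of k] t[OF i] sum by algebra
      then show False using jk by simp
    qed
    moreover have "P = - ((x i ^ 2) ^ 3)" for i
    proof -
      have "p2 = (\<Sum>e::edge\<in>UNIV. x i ^ 2)" unfolding p2_def by (intro sum.cong refl eq)
      then have p: "p2 = 6 * x i ^ 2" by (simp add: card_edge)
      obtain j where j: "i \<noteq> j" by (cases i) auto
      show ?thesis using N[OF j] eq[of i j] p by algebra
    qed
    ultimately show ?thesis unfolding P_def by blast
  qed
  show "x i ^ 2 = x j ^ 2" "(\<Prod>e\<in>UNIV. x e) = - ((x i ^ 2) ^ 3)" using all by blast+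
qed

text \<open>Scaling each coordinate by its sign leaves even powers alone and reverses the product,
  which reduces the claim to the all-ones point of the sextic with \<open>-48\<close> in place of
  \<open>48\<close>.\<close>

lemma sign_triple_point:
  assumes sgn: "\<And>e. \<epsilon> e = 1 \<or> \<epsilon> e = -1" and "(\<Prod>e\<in>UNIV. \<epsilon> e) = -1"
  shows "triple_point \<epsilon>"
  unfolding triple_point_def
proof (intro allI impI)
  fix w :: "edge \<Rightarrow> complex" and k :: nat assume "k < 3"
  define \<omega> where "\<omega> e = \<epsilon> e * w e" for e
  have e2: "\<epsilon> e * \<epsilon> e = 1" for e using sgn[of e] by auto
  have lin: "[:\<epsilon> e, w e:] = smult (\<epsilon> e) [:1, \<omega> e:]" for e
    by (simp add: \<omega>_def e2 flip: mult.assoc)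
  have "\<epsilon> e ^ 2 = 1" "\<epsilon> e ^ 4 = 1" "\<epsilon> e ^ 6 = 1" for e using sgn[of e] by auto
  then have pw: "[:\<epsilon> e, w e:] ^ n = [:1, \<omega> e:] ^ n" if "n \<in> {2, 4, 6}" for e n
    using that unfolding lin smult_power by auto
  have pr: "(\<Prod>e\<in>UNIV. [:\<epsilon> e, w e:]) = - (\<Prod>e\<in>UNIV. [:1, \<omega> e:])"
    unfolding lin prod_smult assms(2) by simp
  have b: "(4::nat) choose 2 = 6" "(6::nat) choose 2 = 15" by (simp_all add: numeral_eq_Suc)
  define P where "P k = (\<Sum>e\<in>UNIV. [:1, \<omega> e:] ^ k)" for k
  define Q where "Q = (\<Prod>e\<in>UNIV. [:1, \<omega> e:])"
  define s1 s2 where "s1 = (\<Sum>e\<in>UNIV. \<omega> e)" and "s2 = (\<Sum>e\<in>UNIV. \<omega> e ^ 2)"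
  have P0: "coeff (P k) 0 = 6" if "k \<ge> 2" for k
    using that by (simp add: P_def coeff_sum coeff_linear_power_low card_edge)
  have P1: "coeff (P k) (Suc 0) = of_nat k * s1" if "k \<ge> 2" for k
    using that by (simp add: P_def s1_def coeff_sum coeff_linear_power_low sum_distrib_left mult.assoc)
  have P2: "coeff (P k) 2 = of_nat (k choose 2) * s2" if "k \<ge> 2" for k
    using that by (simp add: P_def s2_def coeff_sum coeff_linear_power_low sum_distrib_left mult.assoc)
  have Q: "coeff Q 0 = 1" "coeff Q (Suc 0) = s1" "2 * coeff Q 2 = s1\<^sup>2 - s2"
    unfolding Q_def prod_edge coeff_mult_low s1_def s2_def sum_edge
    by (simp_all add: numeral_2_eq_2 algebra_simps)
  have eq: "line_poly \<epsilon> w = P 2 * P 2 * P 2 - smult 6 (P 2 * P 4) + smult 8 (P 6) - smult 48 Q"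
    unfolding line_poly_def sextic_def pr P_def Q_def
    by (simp add: pw numeral_poly power3_eq_cube)
  consider "k = 0" | "k = Suc 0" | "k = 2" using \<open>k < 3\<close> by linarith
  then show "coeff (line_poly \<epsilon> w) k = 0"
  proof cases
    case 1
    show ?thesis unfolding 1 eq by (simp add: coeff_mult_low P0 Q)
  next
    case 2
    show ?thesis unfolding 2 eq by (simp add: coeff_mult_low P0 P1 Q)
  next
    case 3
    have "coeff (line_poly \<epsilon> w) 2 = coeff (P 2 * P 2 * P 2) 2 - 6 * coeff (P 2 * P 4) 2 + 8 * coeff (P 6) 2 - 24 * (2 * coeff Q 2)"
      unfolding eq by simp
    also have "\<dots> = 0"
      unfolding Q coeff_mult_low by (simp add: P0 P1 P2 b power2_eq_square algebra_simps)
    finally show ?thesis unfolding 3 .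
  qed
qed

section \<open>Matrices preserving the triple points\<close>

text \<open>The sum of \<open>(a + b \<plusminus> c \<plusminus> d \<plusminus> e \<plusminus> f)\<^sup>2\<close> minus that of \<open>(a - b \<plusminus> c \<plusminus> d \<plusminus> e \<plusminus> f)\<^sup>2\<close>, over all
  choices for which the total number of minus signs is odd.\<close>
lemma product_from_odd_sign_sums:
  fixes a b c d e f :: complex
  shows "32 * (a * b) =
    ((a+b-c+d+e+f)\<^sup>2 + (a+b+c-d+e+f)\<^sup>2 + (a+b+c+d-e+f)\<^sup>2 + (a+b+c+d+e-f)\<^sup>2
     + (a+b+c-d-e-f)\<^sup>2 + (a+b-c+d-e-f)\<^sup>2 + (a+b-c-d+e-f)\<^sup>2 + (a+b-c-d-e+f)\<^sup>2)
    - ((a-b+c+d+e+f)\<^sup>2 + (a-b-c-d+e+f)\<^sup>2 + (a-b-c+d-e+f)\<^sup>2 + (a-b-c+d+e-f)\<^sup>2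
     + (a-b+c-d-e+f)\<^sup>2 + (a-b+c-d+e-f)\<^sup>2 + (a-b+c+d-e-f)\<^sup>2 + (a-b-c-d-e-f)\<^sup>2)"
  by algebra

text \<open>Naming the other four edges lets one computation serve all pairs \<open>k\<close>,
  \<open>l\<close>.\<close>

lemma distinct_edges_exhaust:
  fixes k l :: edge
  assumes "k \<noteq> l"
  obtains m n q r where "distinct [k, l, m, n, q, r]" "UNIV = {k, l, m, n, q, r}"
proof -
  obtain xs where xs: "set xs = UNIV - {k, l}" "distinct xs"
    using finite_distinct_list[of "UNIV - {k, l}"] by auto
  have "length xs = 4"
    using distinct_card[OF xs(2)] xs(1) assms by (simp add: card_Diff_subset card_edge)
  then obtain m n q r where "xs = [m, n, q, r]" by (auto simp: numeral_eq_Suc length_Suc_conv)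
  then show ?thesis using that[of m n q r] xs assms by auto
qed

definition sign_fun :: "('a \<Rightarrow> 'b::comm_ring_1) \<Rightarrow> bool" where
  "sign_fun s \<longleftrightarrow> (\<forall>i. s i = 1 \<or> s i = -1)"

text \<open>The difference of the two squared linear forms vanishes on odd sign vectors, so its
  off-diagonal coefficients vanish. Negation preserves oddness in six coordinates and does not
  affect squares, hence the sixteen patterns with sign 1 at \<open>k\<close> suffice.\<close>

lemma row_products_equal:
  fixes a b :: "edge \<Rightarrow> complex"
  assumes H: "\<And>\<epsilon>. sign_fun \<epsilon> \<Longrightarrow> (\<Prod>e\<in>UNIV. \<epsilon> e) = -1 \<Longrightarrow> (\<Sum>e\<in>UNIV. a e * \<epsilon> e)\<^sup>2 = (\<Sum>e\<in>UNIV. b e * \<epsilon> e)\<^sup>2"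
    and "k \<noteq> l"
  shows "a k * a l = b k * b l"
proof -
  obtain m n q r where d: "distinct [k, l, m, n, q, r]" and U: "UNIV = {k, l, m, n, q, r}"
    using distinct_edges_exhaust[OF \<open>k \<noteq> l\<close>] .
  have S: "(a k * s1 + a l * s2 + a m * s3 + a n * s4 + a q * s5 + a r * s6)\<^sup>2
         = (b k * s1 + b l * s2 + b m * s3 + b n * s4 + b q * s5 + b r * s6)\<^sup>2"
    if "s1 \<in> {1,-1}" "s2 \<in> {1,-1}" "s3 \<in> {1,-1}" "s4 \<in> {1,-1}" "s5 \<in> {1,-1}" "s6 \<in> {1,-1}"
      "s1 * s2 * s3 * s4 * s5 * s6 = -1" for s1 s2 s3 s4 s5 s6
  proof -
    define \<epsilon> where "\<epsilon> = (\<lambda>_. 1)(k := s1, l := s2, m := s3, n := s4, q := s5, r := s6)"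
    have "sign_fun \<epsilon>" using that d by (auto simp: sign_fun_def \<epsilon>_def)
    moreover have "(\<Prod>e\<in>UNIV. \<epsilon> e) = -1" unfolding U using that(7) d by (simp add: \<epsilon>_def mult_ac)
    ultimately have "(\<Sum>e\<in>UNIV. a e * \<epsilon> e)\<^sup>2 = (\<Sum>e\<in>UNIV. b e * \<epsilon> e)\<^sup>2" by (rule H)
    moreover have "(\<Sum>e\<in>UNIV. f e * \<epsilon> e) = f k * s1 + f l * s2 + f m * s3 + f n * s4 + f q * s5 + f r * s6"
      for f :: "edge \<Rightarrow> complex"
      unfolding U using d by (simp add: \<epsilon>_def add_ac)
    ultimately show ?thesis by simp
  qed
  have "32 * (a k * a l) = 32 * (b k * b l)"
    unfolding product_from_odd_sign_sums[of "a k" "a l" "a m" "a n" "a q" "a r"]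
      product_from_odd_sign_sums[of "b k" "b l" "b m" "b n" "b q" "b r"]
    using S[of 1 1 "-1" 1 1 1] S[of 1 1 1 "-1" 1 1] S[of 1 1 1 1 "-1" 1] S[of 1 1 1 1 1 "-1"]
      S[of 1 1 1 "-1" "-1" "-1"] S[of 1 1 "-1" 1 "-1" "-1"] S[of 1 1 "-1" "-1" 1 "-1"] S[of 1 1 "-1" "-1" "-1" 1]
      S[of 1 "-1" 1 1 1 1] S[of 1 "-1" "-1" "-1" 1 1] S[of 1 "-1" "-1" 1 "-1" 1] S[of 1 "-1" "-1" 1 1 "-1"]
      S[of 1 "-1" 1 "-1" "-1" 1] S[of 1 "-1" 1 "-1" 1 "-1"] S[of 1 "-1" 1 1 "-1" "-1"] S[of 1 "-1" "-1" "-1" "-1" "-1"]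
    by simp
  then show ?thesis by simp
qed

text \<open>Indexed by rows: the entry of row \<open>i\<close> stands in column \<open>p i\<close>.
  Products therefore compose the permutations in reverse order.\<close>

definition signed_mat :: "('n \<Rightarrow> 'n) \<Rightarrow> ('n \<Rightarrow> 'a::comm_ring_1) \<Rightarrow> 'a ^ 'n ^ 'n" where
  "signed_mat p s = (\<chi> i j. if j = p i then s i else 0)"

lemma signed_mat_mult_vec: "(signed_mat p s *v x) $ i = s i * x $ p i"
  for p :: "'n::finite \<Rightarrow> 'n"
  by (simp add: signed_mat_def matrix_vector_mult_def if_distrib[of "\<lambda>z. z * _"] cong: if_cong)

lemma invertible_imp_column_nonzero:
  fixes M :: "complex ^ 'n ^ 'n"
  assumes "invertible M"
  obtains i where "M $ i $ k \<noteq> 0"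
proof -
  obtain N where N: "N ** M = mat 1" using assms unfolding invertible_def by blast
  have "(\<Sum>i\<in>UNIV. N $ k $ i * M $ i $ k) = 1"
    using N by (simp add: vec_eq_iff matrix_matrix_mult_def mat_def)
  then have "\<exists>i. M $ i $ k \<noteq> 0"
    by (rule contrapos_pp) simp
  then show ?thesis using that by blast
qed

lemma invertible_imp_rows_not_proportional:
  fixes M :: "complex ^ 'n ^ 'n"
  assumes "invertible M" "\<And>k. M $ i $ k = c * M $ j $ k"
  shows "i = j"
proof (rule ccontr)
  assume "i \<noteq> j"
  obtain N where N: "M ** N = mat 1" using assms unfolding invertible_def by blast
  then have 1: "(\<Sum>k\<in>UNIV. M $ i $ k * N $ k $ i) = 1" and 0: "(\<Sum>k\<in>UNIV. M $ j $ k * N $ k $ i) = 0"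
    using \<open>i \<noteq> j\<close> by (simp_all add: vec_eq_iff matrix_matrix_mult_def mat_def)
  have "(\<Sum>k\<in>UNIV. M $ i $ k * N $ k $ i) = c * (\<Sum>k\<in>UNIV. M $ j $ k * N $ k $ i)"
    by (simp add: assms(2) sum_distrib_left mult.assoc)
  then show False using 0 1 by simp
qed

text \<open>Two nonzero entries in one row would make their columns nonzero throughout, and then
  some third column too. Three pairwise products determine the entries up to a common sign, so two
  rows would agree up to sign, against invertibility.\<close>

lemma monomial_of_constant_row_products:
  fixes M :: "complex ^ edge ^ edge"
  assumes inv: "invertible M" and prods: "\<And>i j k l. k \<noteq> l \<Longrightarrow> M $ i $ k * M $ i $ l = M $ j $ k * M $ j $ l"
  obtains p where "bij p" "\<And>i k. M $ i $ k \<noteq> 0 \<longleftrightarrow> k = p i"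
proof -
  have zero: "M $ i $ k * M $ i $ l = 0" if kl: "k \<noteq> l" for i k l
  proof (rule ccontr)
    assume nz: "M $ i $ k * M $ i $ l \<noteq> 0"
    have nzk: "M $ j $ k \<noteq> 0" and nzl: "M $ j $ l \<noteq> 0" for j
      using prods[OF kl, of i j] nz by auto
    obtain j where ij: "i \<noteq> j" by (cases i) auto
    obtain m n q r where d: "distinct [k, l, m, n, q, r]" and "UNIV = {k, l, m, n, q, r}"
      using distinct_edges_exhaust[OF kl] .
    then have m: "m \<noteq> k" "m \<noteq> l" by auto
    obtain g where g: "M $ g $ m \<noteq> 0" using invertible_imp_column_nonzero[OF inv] .
    have "M $ j $ m \<noteq> 0" using prods[OF m(1), of g j] g nzk[of g] by auto
    \<comment> \<open>The square of the entry in column \<open>k\<close> is the product for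
      \<open>k, l\<close> times that for \<open>k, m\<close>, divided by that for
      \<open>l, m\<close>, and all three are the same in every row.\<close>
    have "(M $ i $ k)\<^sup>2 * (M $ j $ l * M $ j $ m) = (M $ j $ k)\<^sup>2 * (M $ j $ l * M $ j $ m)"
      using prods[OF kl, of i j] prods[OF m(1), of i j] prods[OF m(2), of i j] by algebra
    then have "(M $ i $ k)\<^sup>2 = (M $ j $ k)\<^sup>2" using nzl \<open>M $ j $ m \<noteq> 0\<close> by simp
    then obtain \<sigma> where \<sigma>: "\<sigma> * \<sigma> = 1" "M $ i $ k = \<sigma> * M $ j $ k"
      by (metis mult.left_neutral mult_minus1 power2_eq_iff square_eq_1_iff)
    have "M $ i $ n = \<sigma> * M $ j $ n" for n
    proof (cases "n = k")
      case False
      have "M $ j $ k * (\<sigma> * M $ i $ n) = M $ j $ k * M $ j $ n"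
        using prods[OF False, of i j] \<sigma>(2) by algebra
      then have "\<sigma> * M $ i $ n = M $ j $ n" using nzk by simp
      then show ?thesis using \<sigma>(1) by (metis mult.assoc mult.left_neutral)
    qed (use \<sigma> in simp)
    then show False using invertible_imp_rows_not_proportional[OF inv] ij by blast
  qed
  have "\<exists>k. M $ i $ k \<noteq> 0" for i
  proof (rule ccontr)
    assume "\<nexists>k. M $ i $ k \<noteq> 0"
    moreover obtain j where "i \<noteq> j" by (cases i) auto
    ultimately show False using invertible_imp_rows_not_proportional[OF inv, of i 0 j] by simp
  qed
  then obtain p where p: "\<And>i. M $ i $ p i \<noteq> 0" by metis
  have iff: "M $ i $ k \<noteq> 0 \<longleftrightarrow> k = p i" for i k
    using zero[of k "p i" i] p[of i] by auto
  have "surj p" using invertible_imp_column_nonzero[OF inv] iff by (metis surjI surj_def)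
  then have "bij p" by (simp add: bij_def finite_UNIV_surj_inj)
  then show ?thesis using that iff by blast
qed

text \<open>Odd sign vectors probe the matrix: equality of squares gives the monomial shape and
  entries equal up to sign, and the product formula at one probe gives the parity of the
  signs.\<close>

lemma matrix_preserving_triple_points:
  fixes M :: "complex ^ edge ^ edge"
  assumes inv: "invertible M"
    and trip: "\<And>x. triple_point (\<lambda>e. x $ e) \<Longrightarrow> triple_point (\<lambda>e. (M *v x) $ e)"
  obtains \<mu> p s where "\<mu> \<noteq> 0" "bij p" "sign_fun s" "(\<Prod>e\<in>UNIV. s e) = 1" "M = mat \<mu> ** signed_mat p s"
proof -
  have sgn: "triple_point (\<lambda>e. \<Sum>f\<in>UNIV. M $ e $ f * \<epsilon> f)" if "sign_fun \<epsilon>" "(\<Prod>e\<in>UNIV. \<epsilon> e) = -1" for \<epsilon>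
    using trip[of "\<chi> e. \<epsilon> e"] sign_triple_point[of \<epsilon>] that
    by (simp add: sign_fun_def matrix_vector_mult_def)
  note sq = triple_point_imp_equal_squares(1)[OF sgn] and pr = triple_point_imp_equal_squares(2)[OF sgn]
  have "M $ i $ k * M $ i $ l = M $ j $ k * M $ j $ l" if "k \<noteq> l" for i j k l
    using row_products_equal[OF sq that] by blast
  then obtain p where p: "bij p" "\<And>i k. M $ i $ k \<noteq> 0 \<longleftrightarrow> k = p i"
    using monomial_of_constant_row_products[OF inv] by metis
  define m where "m i = M $ i $ p i" for i
  have row: "(\<Sum>f\<in>UNIV. M $ i $ f * \<epsilon> f) = m i * \<epsilon> (p i)" for i \<epsilon>
  proof -
    have "(\<Sum>f\<in>UNIV. M $ i $ f * \<epsilon> f) = (\<Sum>f\<in>UNIV. if f = p i then m i * \<epsilon> (p i) else 0)"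
      using p(2)[of i] by (intro sum.cong) (auto simp: m_def)
    then show ?thesis by simp
  qed
  \<comment> \<open>Any odd sign vector would serve, since its entries are merely permuted.\<close>
  define \<epsilon> :: "edge \<Rightarrow> complex" where "\<epsilon> = (\<lambda>_. 1)(E01 := -1)"
  have \<epsilon>: "sign_fun \<epsilon>" "(\<Prod>e\<in>UNIV. \<epsilon> e) = -1"
    by (simp_all add: sign_fun_def \<epsilon>_def prod_edge)
  have \<epsilon>2: "(\<epsilon> e)\<^sup>2 = 1" for e by (simp add: \<epsilon>_def)
  define \<mu> where "\<mu> = m E01"
  have \<mu>: "\<mu> \<noteq> 0" using p(2) by (simp add: \<mu>_def m_def)
  have m2: "(m i)\<^sup>2 = \<mu>\<^sup>2" for i
    using sq[OF \<epsilon>, of i E01] \<epsilon>2 unfolding row by (simp add: power_mult_distrib \<mu>_def)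
  define s where "s i = m i / \<mu>" for i
  have s: "sign_fun s" unfolding sign_fun_def
  proof
    fix i
    have "(s i)\<^sup>2 = 1" using m2[of i] \<mu> by (simp add: s_def power_divide)
    then show "s i = 1 \<or> s i = -1" by (simp add: power2_eq_1_iff)
  qed
  have ms: "m i = \<mu> * s i" for i using \<mu> by (simp add: s_def)
  have "(\<Prod>i\<in>UNIV. m i * \<epsilon> (p i)) = - ((\<mu>\<^sup>2) ^ 3)"
    using pr[OF \<epsilon>, of E01] \<epsilon>2 unfolding row by (simp add: power_mult_distrib \<mu>_def)
  moreover have "(\<Prod>i\<in>UNIV. \<epsilon> (p i)) = -1"
    using prod.reindex_bij_betw[OF p(1), of \<epsilon>] \<epsilon>(2) by simp
  moreover have "(\<Prod>i\<in>UNIV. m i) = \<mu> ^ 6 * (\<Prod>i\<in>UNIV. s i)"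
    by (simp add: ms prod.distrib card_edge)
  ultimately have "\<mu> ^ 6 * (\<Prod>i\<in>UNIV. s i) = \<mu> ^ 6"
    by (simp add: prod.distrib flip: power_mult)
  then have "(\<Prod>i\<in>UNIV. s i) = 1" using \<mu> by simp
  moreover have "M = mat \<mu> ** signed_mat p s"
    using p(2) ms by (auto simp: vec_eq_iff matrix_matrix_mult_def mat_def signed_mat_def m_def
        if_distrib[of "\<lambda>z. z * _"] cong: if_cong)
  ultimately show ?thesis using that \<mu> p(1) s by blast
qed

section \<open>Change of coordinates\<close>

lemma mat_mult: "mat c ** mat d = (mat (c * d) :: complex ^ 'n ^ 'n)"
  by (simp add: vec_eq_iff matrix_matrix_mult_def mat_def if_distrib[of "\<lambda>z. z * _"] cong: if_cong)

lemma mat_mult_nth: "(mat c ** A) $ i $ j = c * A $ i $ j"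
  for A :: "'a::comm_ring_1 ^ 'n ^ 'n"
  by (simp add: matrix_matrix_mult_def mat_def if_distrib[of "\<lambda>z. z * _"] cong: if_cong)

lemma mult_mat_nth: "(A ** mat c) $ i $ j = c * A $ i $ j"
  for A :: "'a::comm_ring_1 ^ 'n ^ 'n"
  by (simp add: matrix_matrix_mult_def mat_def if_distrib[of "\<lambda>z. _ * z"] mult.commute cong: if_cong)

lemma mat_mult_commute: "mat c ** A = A ** mat c"
  for A :: "'a::comm_ring_1 ^ 'n ^ 'n"
  by (simp add: vec_eq_iff mat_mult_nth mult_mat_nth)

text \<open>Conjugation by \<open>Bmat\<close>, whose inverse is half of itself. Being an
  involution, it translates in both directions between edge lengths and the new coordinates.\<close>

definition edge_coords :: "complex ^ edge ^ edge \<Rightarrow> complex ^ edge ^ edge" where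
  "edge_coords D = mat (1 / 2) ** (Bmat ** D ** Bmat)"

lemma mat_mult_left_commute: "A ** (mat c ** X) = mat c ** (A ** X)"
  for A :: "'a::comm_ring_1 ^ 'n ^ 'n"
  by (simp add: matrix_mul_assoc mat_mult_commute[of c A])

lemma mat_mult_mat: "mat c ** (mat d ** X) = mat (c * d) ** X"
  for X :: "complex ^ 'n ^ 'n"
  by (simp add: matrix_mul_assoc mat_mult)

lemma Bmat_squared_mult: "Bmat ** (Bmat ** X) = mat 2 ** X"
  by (simp add: matrix_mul_assoc Bmat_squared)

lemma edge_coords_mult: "edge_coords D ** edge_coords E = edge_coords (D ** E)"
  by (simp add: edge_coords_def matrix_mul_assoc[symmetric] mat_mult_left_commute[of Bmat] mat_mult_left_commute[of D]
      mat_mult_mat Bmat_squared_mult)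

lemma edge_coords_mat: "edge_coords (mat c) = mat c"
  by (simp add: edge_coords_def matrix_mul_assoc[symmetric] mat_mult_left_commute[of Bmat] mat_mult_mat Bmat_squared mat_mult)

lemma edge_coords_idem: "edge_coords (edge_coords D) = D"
proof -
  have "edge_coords (edge_coords D) = mat (1 / 2) ** (D ** mat 2)"
    by (simp add: edge_coords_def matrix_mul_assoc[symmetric] mat_mult_left_commute[of Bmat] mat_mult_mat Bmat_squared_mult Bmat_squared)
  then show ?thesis by (simp add: mat_mult_mat flip: mat_mult_commute)
qed

lemma edge_coords_scalar: "edge_coords (mat c ** D) = mat c ** edge_coords D"
  by (metis edge_coords_mat edge_coords_mult)

text \<open>Treats rational and real entries at once; the only denominator introduced is 2.\<close>

lemma edge_coords_nth_in_subfield: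
  assumes "\<And>i j. D $ i $ j \<in> K" and "\<And>x y. x \<in> K \<Longrightarrow> y \<in> K \<Longrightarrow> x + y \<in> K \<and> x * y \<in> K"
    and "{0, 1, -1, 1 / 2} \<subseteq> K"
  shows "edge_coords D $ i $ j \<in> K"
proof -
  have sum: "sum f S \<in> K" if "\<And>e. f e \<in> K" for f :: "edge \<Rightarrow> complex" and S
    using that assms(2,3) by (induction S rule: infinite_finite_induct) auto
  have mult: "(X ** Y) $ i $ j \<in> K" if "\<And>i j. X $ i $ j \<in> K" "\<And>i j. Y $ i $ j \<in> K"
    for X Y :: "complex ^ edge ^ edge" and i j
    using that assms(2) by (simp add: matrix_matrix_mult_def sum)
  have "Bmat $ i $ j \<in> K" for i j using assms(3) by (auto simp: Bmat_def)
  then have "(Bmat ** D ** Bmat) $ i $ j \<in> K" using mult assms(1) by blast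
  then show ?thesis
    unfolding edge_coords_def mat_mult_nth using assms(2,3) by blast
qed

lemma edge_coords_real: "(\<And>i j. D $ i $ j \<in> \<real>) \<Longrightarrow> edge_coords D $ i $ j \<in> \<real>"
  by (rule edge_coords_nth_in_subfield) auto

lemma edge_coords_rational: "(\<And>i j. D $ i $ j \<in> \<rat>) \<Longrightarrow> edge_coords D $ i $ j \<in> \<rat>"
  by (rule edge_coords_nth_in_subfield) auto

lemma Bmat_mult_edge_coords: "Bmat *v (edge_coords D *v v) = D *v (Bmat *v v)"
proof -
  have "Bmat ** edge_coords D = D ** Bmat"
    by (simp add: edge_coords_def matrix_mul_assoc[symmetric] mat_mult_left_commute[of Bmat] mat_mult_mat Bmat_squared_mult)
  then show ?thesis by (simp add: matrix_vector_mul_assoc)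
qed

lemma invertible_edge_coords: "invertible D \<Longrightarrow> invertible (edge_coords D)"
  unfolding invertible_def by (metis edge_coords_mult edge_coords_mat)

section \<open>Classification of the linear automorphisms\<close>

lemma lin_aut_iff:
  "lin_aut A \<longleftrightarrow> invertible A \<and> (\<forall>v. A *v v \<in> L24 \<longleftrightarrow> v \<in> L24)"
proof (cases "invertible A")
  case True
  then have "bij ((*v) A)"
    by (simp add: invertible_eq_bij)
  then have "(\<lambda>v. A *v v) ` L24 = L24 \<longleftrightarrow> (\<forall>v. A *v v \<in> L24 \<longleftrightarrow> v \<in> L24)"
    unfolding bij_def inj_def surj_def image_def by (auto 0 3 simp: set_eq_iff)
  then show ?thesis using True by (simp add: lin_aut_def)
qed (simp add: lin_aut_def)

text \<open>Every vector has the form \<open>Bmat *v v\<close>, so in the new coordinates an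
  automorphism preserves the zeros of the sextic, and \<open>sextic_proportional\<close>
  applies.\<close>

lemma triple_point_of_lin_aut:
  assumes "lin_aut A"
  shows "invertible (edge_coords A)"
    and "triple_point (\<lambda>e. x $ e) \<Longrightarrow> triple_point (\<lambda>e. (edge_coords A *v x) $ e)"
proof -
  show inv: "invertible (edge_coords A)" using assms by (simp add: lin_aut_iff invertible_edge_coords)
  have "sextic (\<lambda>e. (edge_coords A *v x) $ e) = 0 \<longleftrightarrow> sextic (\<lambda>e. x $ e) = 0" for x
  proof -
    have "Bmat ** (mat (1/2) ** Bmat) = mat 1"
      by (simp add: mat_mult_left_commute[of Bmat] Bmat_squared mat_mult)
    then have x: "Bmat *v ((mat (1/2) ** Bmat) *v x) = x"
      by (simp only: matrix_vector_mul_assoc matrix_vector_mul_lid)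
    define v where "v = (mat (1/2) ** Bmat) *v x"
    have "sextic (\<lambda>e. (Bmat *v (A *v v)) $ e) = 0 \<longleftrightarrow> sextic (\<lambda>e. (Bmat *v v) $ e) = 0"
      using assms by (simp add: lin_aut_iff flip: L24_iff_sextic)
    then show ?thesis
      using Bmat_mult_edge_coords[of "edge_coords A" v] x by (simp add: edge_coords_idem v_def)
  qed
  then obtain c where "\<And>x. sextic (\<lambda>e. (edge_coords A *v x) $ e) = c * sextic (\<lambda>e. x $ e)"
    using sextic_proportional by blast
  then show "triple_point (\<lambda>e. x $ e) \<Longrightarrow> triple_point (\<lambda>e. (edge_coords A *v x) $ e)"
    using triple_point_image inv by blast
qed

lemma lin_aut_classification:
  assumes "lin_aut A"
  obtains \<mu> p s where "\<mu> \<noteq> 0" "bij p" "sign_fun s" "(\<Prod>e\<in>UNIV. s e) = 1"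
    "A = mat \<mu> ** edge_coords (signed_mat p s)"
proof -
  obtain \<mu> p s where "\<mu> \<noteq> 0" "bij p" "sign_fun s" "(\<Prod>e\<in>UNIV. s e) = 1" "edge_coords A = mat \<mu> ** signed_mat p s"
    using matrix_preserving_triple_points[OF triple_point_of_lin_aut[OF assms]] by blast
  then show ?thesis using that[of \<mu> p s] by (metis edge_coords_idem edge_coords_scalar)
qed

lemma signed_mat_mult: "signed_mat p s ** signed_mat q t = signed_mat (q \<circ> p) (\<lambda>i. s i * t (p i))"
  for p :: "'n::finite \<Rightarrow> 'n"
  by (simp add: vec_eq_iff matrix_matrix_mult_def signed_mat_def if_distrib[of "\<lambda>z. z * _"] cong: if_cong)

lemma signed_mat_id: "signed_mat id (\<lambda>_. 1) = mat 1"
  by (auto simp: signed_mat_def mat_def vec_eq_iff)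

lemma signed_mat_inverse:
  fixes p :: "'n::finite \<Rightarrow> 'n"
  assumes "bij p" "sign_fun s"
  shows "signed_mat p s ** signed_mat (inv_into UNIV p) (\<lambda>i. s (inv_into UNIV p i)) = mat 1"
    and "signed_mat (inv_into UNIV p) (\<lambda>i. s (inv_into UNIV p i)) ** signed_mat p s = mat 1"
proof -
  have s: "s i * s i = 1" for i using assms(2) unfolding sign_fun_def by (metis mult_1 mult_minus1 minus_minus)
  show "signed_mat p s ** signed_mat (inv_into UNIV p) (\<lambda>i. s (inv_into UNIV p i)) = mat 1"
    "signed_mat (inv_into UNIV p) (\<lambda>i. s (inv_into UNIV p i)) ** signed_mat p s = mat 1"
    using assms(1) s unfolding signed_mat_mult signed_mat_id[symmetric]
    by (simp_all add: bij_is_inj bij_is_surj surj_iff[THEN iffD1] fun_eq_iff inv_f_f surj_f_inv_f)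
qed

text \<open>Power sums with even exponents ignore signs and order, and the product feels only the
  product of the signs.\<close>

lemma sextic_signed_mat:
  assumes "bij p" "sign_fun s" "(\<Prod>e\<in>UNIV. s e) = 1"
  shows "sextic (\<lambda>e. (signed_mat p s *v x) $ e) = sextic (\<lambda>e. x $ e)"
proof -
  have "s i ^ 2 = 1" "s i ^ 4 = 1" "s i ^ 6 = 1" for i using assms(2) unfolding sign_fun_def by (metis one_power2 power_minus_even even_numeral power_one)+
  then have "(\<Sum>e\<in>UNIV. (signed_mat p s *v x) $ e ^ k) = (\<Sum>e\<in>UNIV. x $ e ^ k)" if "k \<in> {2, 4, 6}" for k
    using sum.reindex_bij_betw[OF assms(1), of "\<lambda>e. x $ e ^ k"] that
    by (auto simp: signed_mat_mult_vec power_mult_distrib)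
  moreover have "(\<Prod>e\<in>UNIV. (signed_mat p s *v x) $ e) = (\<Prod>e\<in>UNIV. x $ e)"
    using prod.reindex_bij_betw[OF assms(1), of "\<lambda>e. x $ e"] assms(3)
    by (simp add: signed_mat_mult_vec prod.distrib)
  ultimately show ?thesis by (simp add: sextic_def)
qed

lemma lin_aut_scalar_mult:
  assumes "lin_aut A" "c \<noteq> 0"
  shows "lin_aut (mat c ** A)"
proof -
  have "mat c ** mat (1 / c) = (mat 1 :: complex^edge^edge)" "mat (1 / c) ** mat c = (mat 1 :: complex^edge^edge)"
    using assms(2) by (simp_all add: mat_mult)
  then have "invertible (mat c :: complex^edge^edge)" unfolding invertible_def by blast
  then have "invertible (mat c ** A)" using assms(1) by (simp add: lin_aut_iff invertible_mult)
  moreover have "(mat c ** A) *v v \<in> L24 \<longleftrightarrow> v \<in> L24" for v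
  proof -
    have hom: "sextic (\<lambda>e. c * x e) = c ^ 6 * sextic x" for x :: "edge \<Rightarrow> complex"
      by (simp add: sextic_def power_mult_distrib prod.distrib card_edge sum_distrib_left[symmetric])
        (simp add: algebra_simps power_mult_distrib flip: power_mult power_add)
    have "(\<lambda>e. (Bmat *v ((mat c ** A) *v v)) $ e) = (\<lambda>e. c * (Bmat *v (A *v v)) $ e)"
      by (simp add: matrix_vector_mul_assoc mat_mult_left_commute[of Bmat] fun_eq_iff)
         (simp add: matrix_vector_mult_def mat_mult_nth sum_distrib_left mult.assoc flip: matrix_mul_assoc)
    then show ?thesis using assms by (simp add: L24_iff_sextic hom lin_aut_iff)
  qed
  ultimately show ?thesis by (simp add: lin_aut_iff)
qed

lemma lin_aut_signed_mat:
  assumes "bij p" "sign_fun s" "(\<Prod>e\<in>UNIV. s e) = 1"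
  shows "lin_aut (edge_coords (signed_mat p s))"
proof -
  have "invertible (signed_mat p s)" using signed_mat_inverse[OF assms(1,2)] unfolding invertible_def by blast
  then show ?thesis
    by (simp add: lin_aut_iff invertible_edge_coords L24_iff_sextic Bmat_mult_edge_coords sextic_signed_mat[OF assms])
qed

section \<open>The Weyl group\<close>

lemma card_minus_one_entries:
  fixes p :: "'n::finite \<Rightarrow> 'n" and s :: "'n \<Rightarrow> real"
  shows "card {(i, j). signed_mat p s $ i $ j = -1} = card {i. s i = -1}"
proof -
  have "{(i, j). signed_mat p s $ i $ j = -1} = (\<lambda>i. (i, p i)) ` {i. s i = -1}"
    by (auto simp: signed_mat_def split: if_splits)
  then show ?thesis by (simp add: card_image inj_on_def)
qed

lemma prod_sign_fun:
  fixes s :: "'n::finite \<Rightarrow> real"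
  assumes "sign_fun s"
  shows "(\<Prod>i\<in>UNIV. s i) = (-1) ^ card {i. s i = -1}"
proof -
  have "(\<Prod>i\<in>UNIV. s i) = (\<Prod>i\<in>UNIV. if s i = -1 then -1 else 1)"
    using assms by (intro prod.cong) (auto simp: sign_fun_def)
  then show ?thesis by (simp flip: prod.inter_filter)
qed

lemma sign_fun_cases: "sign_fun s \<Longrightarrow> s i = 1 \<or> s i = -1"
  by (simp add: sign_fun_def)

lemma WeylD6_simps: "x \<otimes>\<^bsub>WeylD6\<^esub> y = x ** y" "\<one>\<^bsub>WeylD6\<^esub> = mat 1"
  by (simp_all add: WeylD6_def)

text \<open>Each row selects a column, injectively because each column has one nonzero entry. The
  even count of minus signs turns into a product condition, which is easier to multiply.\<close>

lemma WeylD6_iff: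
  "N \<in> carrier WeylD6 \<longleftrightarrow> (\<exists>p s. bij p \<and> sign_fun s \<and> (\<Prod>i\<in>UNIV. s i) = 1 \<and> N = signed_mat p s)"
proof
  assume N: "N \<in> carrier WeylD6"
  then have e: "N $ i $ j \<in> {-1, 0, 1}" and r: "\<exists>!j. N $ i $ j \<noteq> 0" and c: "\<exists>!i. N $ i $ j \<noteq> 0" for i j
    by (auto simp: WeylD6_def signed_perm_mat_def)
  obtain p where p: "\<And>i. N $ i $ p i \<noteq> 0" using r by metis
  have z: "N $ i $ j = 0" if "j \<noteq> p i" for i j using r[of i] p[of i] that by blast
  have "inj p" using c p by (metis injI)
  then have "bij p" by (simp add: bij_def finite_UNIV_inj_surj)
  moreover define s where "s i = N $ i $ p i" for i
  have s: "sign_fun s" using e p by (force simp: sign_fun_def s_def)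
  moreover have Ns: "N = signed_mat p s" using z by (simp add: vec_eq_iff signed_mat_def s_def)
  moreover have "even (card {i. s i = -1})"
    using N unfolding Ns by (simp add: WeylD6_def card_minus_one_entries)
  then have "(\<Prod>i\<in>UNIV. s i) = 1" using prod_sign_fun[OF s] by simp
  ultimately show "\<exists>p s. bij p \<and> sign_fun s \<and> (\<Prod>i\<in>UNIV. s i) = 1 \<and> N = signed_mat p s" by blast
next
  assume "\<exists>p s. bij p \<and> sign_fun s \<and> (\<Prod>i\<in>UNIV. s i) = 1 \<and> N = signed_mat p s"
  then obtain p s where ps: "bij p" "sign_fun s" "(\<Prod>i\<in>UNIV. s i) = 1" "N = signed_mat p s" by blast
  have nz: "s i \<noteq> 0" for i using sign_fun_cases[OF ps(2), of i] by auto
  have entry: "N $ i $ j \<noteq> 0 \<longleftrightarrow> j = p i" for i j using nz by (simp add: ps(4) signed_mat_def)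
  have "N $ i $ j \<in> {-1, 0, 1}" for i j
    using sign_fun_cases[OF ps(2), of i] by (auto simp: ps(4) signed_mat_def)
  moreover have "\<exists>!i. N $ i $ j \<noteq> 0" for j
    unfolding entry using ps(1) by (metis bij_pointE)
  moreover have "even (card {i. s i = -1})"
    using prod_sign_fun[OF ps(2)] ps(3) by (cases "even (card {i. s i = -1})") auto
  ultimately show "N \<in> carrier WeylD6"
    by (simp add: WeylD6_def signed_perm_mat_def entry) (simp add: ps(4) card_minus_one_entries)
qed

lemma WeylD6_inverse:
  assumes "N \<in> carrier WeylD6"
  obtains N' where "N' \<in> carrier WeylD6" "N ** N' = mat 1" "N' ** N = mat 1"
proof -
  obtain p s where ps: "bij p" "sign_fun s" "(\<Prod>i\<in>UNIV. s i) = 1" "N = signed_mat p s"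
    using assms WeylD6_iff by blast
  have b: "bij (inv_into UNIV p)" using ps(1) by (rule bij_imp_bij_inv)
  have "(\<Prod>i\<in>UNIV. s (inv_into UNIV p i)) = 1"
    using prod.reindex_bij_betw[OF b, of s] ps(3) by simp
  then have "signed_mat (inv_into UNIV p) (\<lambda>i. s (inv_into UNIV p i)) \<in> carrier WeylD6"
    unfolding WeylD6_iff using b sign_fun_cases[OF ps(2)]
    by (intro exI[of _ "inv_into UNIV p"] exI[of _ "\<lambda>i. s (inv_into UNIV p i)"]) (simp add: sign_fun_def)
  then show ?thesis using that signed_mat_inverse[OF ps(1,2)] ps(4) by blast
qed

lemma WeylD6_mult_closed:
  assumes "M \<in> carrier WeylD6" "N \<in> carrier WeylD6"
  shows "M ** N \<in> carrier WeylD6"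
proof -
  obtain p s where ps: "bij p" "sign_fun s" "(\<Prod>i\<in>UNIV. s i) = 1" "M = signed_mat p s"
    using assms WeylD6_iff by blast
  obtain q t where qt: "bij q" "sign_fun t" "(\<Prod>i\<in>UNIV. t i) = 1" "N = signed_mat q t"
    using assms WeylD6_iff by blast
  have "bij (q \<circ> p)" using ps(1) qt(1) by (rule bij_comp)
  moreover have "sign_fun (\<lambda>i. s i * t (p i))"
    unfolding sign_fun_def
  proof
    fix i show "s i * t (p i) = 1 \<or> s i * t (p i) = - 1"
      using sign_fun_cases[OF ps(2), of i] sign_fun_cases[OF qt(2), of "p i"] by auto
  qed
  moreover have "(\<Prod>i\<in>UNIV. s i * t (p i)) = 1"
    using prod.reindex_bij_betw[OF ps(1), of t] ps(3) qt(3) by (simp add: prod.distrib)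
  ultimately show ?thesis unfolding ps(4) qt(4) signed_mat_mult WeylD6_iff by blast
qed

text \<open>The scalar \<open>-1\<close> qualifies because six is even; this central element
  accounts for the factor 2 between the two quotients.\<close>

lemma WeylD6_scalar: "c = 1 \<or> c = -1 \<Longrightarrow> mat c \<in> carrier WeylD6"
proof -
  assume c: "c = 1 \<or> c = -1"
  have "mat c = signed_mat id (\<lambda>_. c)" by (auto simp: mat_def signed_mat_def vec_eq_iff)
  moreover have "sign_fun (\<lambda>_. c)" using c by (simp add: sign_fun_def)
  moreover have "(\<Prod>i\<in>(UNIV::6 set). c) = 1" using c by auto
  ultimately show ?thesis unfolding WeylD6_iff using bij_id by blast
qed

lemma group_WeylD6: "group WeylD6"
proof (rule groupI)
  show "\<one>\<^bsub>WeylD6\<^esub> \<in> carrier WeylD6" using WeylD6_scalar[of 1] by (simp add: WeylD6_simps)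
  show "\<exists>y\<in>carrier WeylD6. y \<otimes>\<^bsub>WeylD6\<^esub> x = \<one>\<^bsub>WeylD6\<^esub>" if "x \<in> carrier WeylD6" for x
    using WeylD6_inverse[OF that] unfolding WeylD6_simps by blast
  show "x \<otimes>\<^bsub>WeylD6\<^esub> y \<in> carrier WeylD6" if "x \<in> carrier WeylD6" "y \<in> carrier WeylD6" for x y
    using WeylD6_mult_closed[OF that] by (simp add: WeylD6_simps)
qed (simp_all add: WeylD6_simps matrix_mul_assoc)

text \<open>Toggling membership of one fixed element pairs even subsets with odd ones.\<close>

lemma card_even_subsets: "2 * card {S :: 'n::finite set. even (card S)} = 2 ^ CARD('n)"
proof -
  fix a :: 'n
  define f where "f S = (if a \<in> S then S - {a} else insert a S)" for S
  have ff: "f (f S) = S" for S by (auto simp: f_def)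
  have par: "even (card (f S)) \<longleftrightarrow> odd (card S)" for S
    by (cases "a \<in> S") (auto simp: f_def card_Diff_singleton_if card_gt_0_iff)
  have "bij_betw f {S. even (card S)} {S. odd (card S)}"
    by (rule bij_betw_byWitness[where f' = f]) (auto simp: ff par)
  then have eq: "card {S::'n set. even (card S)} = card {S::'n set. odd (card S)}" by (rule bij_betw_same_card)
  have "card (UNIV :: 'n set set) = card {S::'n set. even (card S)} + card {S::'n set. odd (card S)}"
    by (subst card_Un_disjoint[symmetric]) (auto simp: Collect_disj_eq[symmetric])
  then show ?thesis using eq by (simp add: card_Pow flip: Pow_UNIV)
qed

text \<open>A permutation and the even set of rows carrying a minus sign can be chosen
  independently: \<open>6! * 2^5\<close>.\<close>

lemma order_WeylD6: "order WeylD6 = 23040"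
proof -
  define F :: "(6 \<Rightarrow> 6) \<times> 6 set \<Rightarrow> real ^ 6 ^ 6" where "F = (\<lambda>(p, S). signed_mat p (\<lambda>i. if i \<in> S then -1 else 1))"
  define X where "X = {p :: 6 \<Rightarrow> 6. p permutes UNIV} \<times> {S :: 6 set. even (card S)}"
  have sgn: "sign_fun (\<lambda>i. if i \<in> S then -1 else 1 :: real)" for S :: "6 set" by (simp add: sign_fun_def)
  have pr: "(\<Prod>i\<in>UNIV. if i \<in> S then -1 else 1 :: real) = (-1) ^ card S" for S :: "6 set"
    using prod_sign_fun[OF sgn[of S]] by simp
  have "inj_on F X"
  proof (rule inj_onI, clarify)
    fix p S q T assume eq: "F (p, S) = F (q, T)"
    then have e: "(if j = p i then (if i \<in> S then -1 else 1) else 0) = (if j = q i then (if i \<in> T then -1 else 1) else (0::real))" for i j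
      by (simp add: F_def signed_mat_def vec_eq_iff)
    have "p i = q i" for i using e[of "p i" i] by (auto split: if_splits)
    moreover have "i \<in> S \<longleftrightarrow> i \<in> T" for i using e[of "p i" i] \<open>p i = q i\<close> by (auto split: if_splits)
    ultimately show "p = q \<and> S = T" by auto
  qed
  moreover have "F ` X = carrier WeylD6"
  proof (intro equalityI subsetI)
    fix N assume "N \<in> F ` X"
    then obtain p S where N: "p permutes UNIV" "even (card S)" "N = F (p, S)" by (auto simp: X_def)
    then show "N \<in> carrier WeylD6"
      unfolding WeylD6_iff F_def using sgn[of S] pr[of S] permutes_bij[of p UNIV] by auto
  next
    fix N assume "N \<in> carrier WeylD6"
    then obtain p s where ps: "bij p" "sign_fun s" "(\<Prod>i\<in>UNIV. s i) = 1" "N = signed_mat p s"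
      unfolding WeylD6_iff by blast
    have "N = F (p, {i. s i = -1})" unfolding F_def ps(4) using sign_fun_cases[OF ps(2)]
      by (auto simp: signed_mat_def vec_eq_iff)
    moreover have "even (card {i. s i = -1})"
      using prod_sign_fun[OF ps(2)] ps(3) by (cases "even (card {i. s i = -1})") auto
    ultimately show "N \<in> F ` X" using bij_imp_permutes[OF ps(1)] by (simp add: X_def)
  qed
  ultimately have "order WeylD6 = card X" unfolding order_def by (metis card_image)
  moreover have "card {p :: 6 \<Rightarrow> 6. p permutes UNIV} = fact 6" by (rule card_permutations) simp_all
  moreover have "card {S :: 6 set. even (card S)} = 32" using card_even_subsets[where 'n = 6] by simp
  ultimately show ?thesis by (simp add: X_def card_cartesian_product fact_numeral)
qed

section \<open>Quotients by scalars\<close>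

text \<open>Any bijection will do, because the Weyl group is invariant under simultaneous reindexing
  of rows and columns.\<close>

definition edge_index :: "edge \<Rightarrow> 6" where
  "edge_index = (SOME h. bij h)"

lemma bij_edge_index: "bij edge_index"
proof -
  have "\<exists>h. bij (h :: edge \<Rightarrow> 6)"
    using finite_same_card_bij[of "UNIV :: edge set" "UNIV :: 6 set"] by (simp add: card_edge)
  then show ?thesis unfolding edge_index_def by (rule someI_ex)
qed

definition weyl_rep :: "real ^ 6 ^ 6 \<Rightarrow> complex ^ edge ^ edge" where
  "weyl_rep N = edge_coords (\<chi> e f. complex_of_real (N $ edge_index e $ edge_index f))"

lemma weyl_rep_mult: "weyl_rep (M ** N) = weyl_rep M ** weyl_rep N"
proof -
  have "(\<Sum>k\<in>UNIV. M $ i $ k * N $ k $ j) = (\<Sum>e\<in>UNIV. M $ i $ edge_index e * N $ edge_index e $ j)" for i j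
    using sum.reindex_bij_betw[OF bij_edge_index, of "\<lambda>k. M $ i $ k * N $ k $ j"] by simp
  then have "(\<chi> e f. complex_of_real ((M ** N) $ edge_index e $ edge_index f))
      = (\<chi> e f. complex_of_real (M $ edge_index e $ edge_index f)) ** (\<chi> e f. complex_of_real (N $ edge_index e $ edge_index f))"
    by (simp add: matrix_matrix_mult_def)
  then show ?thesis by (simp add: weyl_rep_def edge_coords_mult)
qed

lemma weyl_rep_mat: "weyl_rep (mat c) = mat (complex_of_real c)"
proof -
  have "(\<chi> e f. complex_of_real (mat c $ edge_index e $ edge_index f)) = mat (complex_of_real c)"
    using bij_edge_index by (auto simp: mat_def vec_eq_iff bij_def inj_eq)
  then show ?thesis by (simp add: weyl_rep_def edge_coords_mat)
qed

text \<open>Faithfulness up to scalars, from which the kernels of both quotient maps are read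
  off.\<close>

lemma weyl_rep_scalar:
  assumes "weyl_rep M = mat c ** weyl_rep N"
  shows "complex_of_real (M $ i $ j) = c * complex_of_real (N $ i $ j)"
proof -
  let ?E = "\<lambda>N::real^6^6. \<chi> e f. complex_of_real (N $ edge_index e $ edge_index f)"
  have "?E M = mat c ** ?E N"
    using assms unfolding weyl_rep_def by (metis edge_coords_idem edge_coords_scalar)
  moreover obtain e f where "i = edge_index e" "j = edge_index f"
    using bij_edge_index by (metis bij_pointE)
  ultimately show ?thesis by (simp add: vec_eq_iff mat_mult_nth)
qed

lemma weyl_rep_signed_mat:
  "weyl_rep (signed_mat p s) = edge_coords (signed_mat (inv_into UNIV edge_index \<circ> p \<circ> edge_index) (\<lambda>e. complex_of_real (s (edge_index e))))"
proof -
  have "edge_index f = p (edge_index e) \<longleftrightarrow> f = inv_into UNIV edge_index (p (edge_index e))" for e f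
    using bij_edge_index by (metis bij_inv_eq_iff)
  then have "(\<chi> e f. complex_of_real (signed_mat p s $ edge_index e $ edge_index f))
      = signed_mat (inv_into UNIV edge_index \<circ> p \<circ> edge_index) (\<lambda>e. complex_of_real (s (edge_index e)))"
    by (simp add: signed_mat_def vec_eq_iff)
  then show ?thesis by (simp add: weyl_rep_def)
qed

lemma lin_aut_weyl_rep:
  assumes "N \<in> carrier WeylD6"
  shows "lin_aut (weyl_rep N)"
proof -
  obtain p s where ps: "bij p" "sign_fun s" "(\<Prod>i\<in>UNIV. s i) = 1" "N = signed_mat p s"
    using assms WeylD6_iff by blast
  have "bij (inv_into UNIV edge_index \<circ> p \<circ> edge_index)"
    using ps(1) bij_edge_index by (intro bij_comp bij_imp_bij_inv)
  moreover have "sign_fun (\<lambda>e. complex_of_real (s (edge_index e)))"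
    unfolding sign_fun_def using sign_fun_cases[OF ps(2)] by (metis of_real_1 of_real_minus)
  moreover have "(\<Prod>e\<in>UNIV. complex_of_real (s (edge_index e))) = 1"
    using prod.reindex_bij_betw[OF bij_edge_index, of s] ps(3) by (simp flip: of_real_prod)
  ultimately show ?thesis unfolding ps(4) weyl_rep_signed_mat by (rule lin_aut_signed_mat)
qed

lemma weyl_rep_rational:
  assumes "N \<in> carrier WeylD6"
  shows "weyl_rep N $ i $ j \<in> \<rat>"
  unfolding weyl_rep_def
proof (rule edge_coords_rational)
  fix e f
  have "N $ edge_index e $ edge_index f \<in> {-1, 0, 1}"
    using assms by (simp add: WeylD6_def signed_perm_mat_def)
  then show "(\<chi> e f. complex_of_real (N $ edge_index e $ edge_index f)) $ e $ f \<in> \<rat>"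
    by auto
qed

lemma weyl_rep_real: "weyl_rep N $ i $ j \<in> \<real>"
  unfolding weyl_rep_def by (rule edge_coords_real) simp

lemma lin_aut_eq_weyl_rep:
  assumes "lin_aut A"
  obtains \<mu> N where "\<mu> \<noteq> 0" "N \<in> carrier WeylD6" "A = mat \<mu> ** weyl_rep N"
proof -
  obtain \<mu> p s where *: "\<mu> \<noteq> 0" "bij p" "sign_fun s" "(\<Prod>e\<in>UNIV. s e) = 1"
    "A = mat \<mu> ** edge_coords (signed_mat p s)"
    using lin_aut_classification[OF assms] .
  define h where "h = inv_into UNIV edge_index"
  have h: "bij h" "\<And>e. h (edge_index e) = e"
    using bij_edge_index by (simp_all add: h_def bij_imp_bij_inv bij_is_inj)
  define p' s' where "p' = edge_index \<circ> p \<circ> h" and "s' = (\<lambda>i. Re (s (h i)))"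
  have s: "complex_of_real (Re (s e)) = s e" for e using sign_fun_cases[OF *(3), of e] by auto
  have "bij p'" unfolding p'_def by (intro bij_comp bij_edge_index h *)
  moreover have "sign_fun s'" unfolding sign_fun_def s'_def using sign_fun_cases[OF *(3)]
    by (metis one_complex.simps(1) uminus_complex.simps(1))
  moreover have "(\<Prod>i\<in>UNIV. s' i) = 1"
  proof -
    have "complex_of_real (\<Prod>i\<in>UNIV. s' i) = (\<Prod>e\<in>UNIV. s e)"
      using prod.reindex_bij_betw[OF h(1), of s] by (simp add: s'_def s)
    then show ?thesis using *(4) by (metis of_real_eq_1_iff)
  qed
  ultimately have "signed_mat p' s' \<in> carrier WeylD6" unfolding WeylD6_iff by blast
  moreover have "weyl_rep (signed_mat p' s') = edge_coords (signed_mat p s)"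
    unfolding weyl_rep_signed_mat h_def[symmetric] by (simp add: p'_def s'_def h s comp_def)
  ultimately show ?thesis using that *(1,5) by metis
qed

lemma invertible_entry_nonzero:
  fixes A :: "complex ^ edge ^ edge"
  assumes "lin_aut A" obtains i j where "A $ i $ j \<noteq> 0"
  using invertible_imp_column_nonzero assms lin_aut_iff by metis

text \<open>The scalar is a quotient of two real entries at a position where
  \<open>weyl_rep N\<close> does not vanish.\<close>

lemma real_lin_aut_scalar:
  assumes "lin_aut (weyl_rep N)" "\<And>i j. (mat \<mu> ** weyl_rep N) $ i $ j \<in> \<real>"
  shows "\<mu> \<in> \<real>"
proof -
  obtain i j where ij: "weyl_rep N $ i $ j \<noteq> 0" using invertible_entry_nonzero[OF assms(1)] .
  have "\<mu> = (mat \<mu> ** weyl_rep N) $ i $ j / weyl_rep N $ i $ j" using ij by (simp add: mat_mult_nth)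
  then show ?thesis using assms(2) weyl_rep_real by (metis Reals_divide)
qed

text \<open>\<open>K\<close> is the group of scalars allowed in the matrix group and \<open>L\<close> the subgroup that is divided out,
  so that the complex and the real quotient are handled together.\<close>
locale scalar_quotient =
  fixes K L :: "complex set"
  assumes K0: "0 \<notin> K" and L1: "1 \<in> L" and LK: "L \<subseteq> K"
    and K_mult: "\<And>x y. x \<in> K \<Longrightarrow> y \<in> K \<Longrightarrow> x * y \<in> K" and K_inverse: "\<And>x. x \<in> K \<Longrightarrow> inverse x \<in> K"
    and L_mult: "\<And>x y. x \<in> L \<Longrightarrow> y \<in> L \<Longrightarrow> x * y \<in> L" and L_inverse: "\<And>x. x \<in> L \<Longrightarrow> inverse x \<in> L"
    and K_sign: "\<And>x. x \<in> K \<Longrightarrow> x \<in> L \<or> - x \<in> L"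
begin

definition G :: "(complex ^ edge ^ edge) monoid" where
  "G = \<lparr>carrier = {mat \<mu> ** weyl_rep N | \<mu> N. \<mu> \<in> K \<and> N \<in> carrier WeylD6}, mult = (**), one = mat 1\<rparr>"

definition H :: "(complex ^ edge ^ edge) set" where
  "H = {mat c | c. c \<in> L}"

lemma G_simps: "x \<otimes>\<^bsub>G\<^esub> y = x ** y" "\<one>\<^bsub>G\<^esub> = mat 1"
  by (simp_all add: G_def)

lemma G_carrier: "A \<in> carrier G \<longleftrightarrow> (\<exists>\<mu> N. \<mu> \<in> K \<and> N \<in> carrier WeylD6 \<and> A = mat \<mu> ** weyl_rep N)"
  by (auto simp: G_def)

lemma G_mult: "(mat \<mu> ** weyl_rep M) ** (mat \<nu> ** weyl_rep N) = mat (\<mu> * \<nu>) ** weyl_rep (M ** N)"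
  by (simp add: weyl_rep_mult matrix_mul_assoc[symmetric] mat_mult_left_commute[of "weyl_rep M"] mat_mult_mat)

lemma mat_in_G: "c \<in> K \<Longrightarrow> mat c \<in> carrier G"
  using WeylD6_scalar[of 1] weyl_rep_mat[of 1] unfolding G_carrier by (metis matrix_mul_rid of_real_1)

lemma weyl_rep_in_G: "N \<in> carrier WeylD6 \<Longrightarrow> weyl_rep N \<in> carrier G"
  using L1 LK unfolding G_carrier by (metis matrix_mul_lid subsetD)

lemma group_G: "group G"
proof (rule groupI)
  show "\<one>\<^bsub>G\<^esub> \<in> carrier G" using mat_in_G L1 LK by (auto simp: G_simps)
  show "x \<otimes>\<^bsub>G\<^esub> y \<in> carrier G" if x: "x \<in> carrier G" and y: "y \<in> carrier G" for x y
  proof -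
    obtain \<mu> M where M: "\<mu> \<in> K" "M \<in> carrier WeylD6" "x = mat \<mu> ** weyl_rep M" using x G_carrier by blast
    obtain \<nu> N where N: "\<nu> \<in> K" "N \<in> carrier WeylD6" "y = mat \<nu> ** weyl_rep N" using y G_carrier by blast
    have "x \<otimes>\<^bsub>G\<^esub> y = mat (\<mu> * \<nu>) ** weyl_rep (M ** N)" by (simp add: G_simps M N G_mult)
    then show ?thesis using K_mult WeylD6_mult_closed M N G_carrier by blast
  qed
  show "\<exists>y\<in>carrier G. y \<otimes>\<^bsub>G\<^esub> x = \<one>\<^bsub>G\<^esub>" if x: "x \<in> carrier G" for x
  proof -
    obtain \<mu> M where M: "\<mu> \<in> K" "M \<in> carrier WeylD6" "x = mat \<mu> ** weyl_rep M" using x G_carrier by blast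
    obtain N where N: "N \<in> carrier WeylD6" "N ** M = mat 1" using WeylD6_inverse[OF M(2)] by blast
    have "(mat (inverse \<mu>) ** weyl_rep N) ** x = mat 1"
      using M(1) K0 N(2) weyl_rep_mat[of 1] unfolding M(3) G_mult by (metis left_inverse matrix_mul_lid of_real_1)
    moreover have "mat (inverse \<mu>) ** weyl_rep N \<in> carrier G" using K_inverse[OF M(1)] N(1) G_carrier by blast
    ultimately show ?thesis unfolding G_simps by blast
  qed
qed (simp_all add: G_simps matrix_mul_assoc)

lemma normal_H: "H \<lhd> G"
proof (rule group.normalI[OF group_G])
  show "subgroup H G"
  proof (rule group.subgroupI[OF group_G])
    show "H \<subseteq> carrier G" using mat_in_G LK by (auto simp: H_def)
    show "H \<noteq> {}" using L1 by (auto simp: H_def)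
    fix a b assume "a \<in> H" "b \<in> H"
    then show "a \<otimes>\<^bsub>G\<^esub> b \<in> H" using L_mult by (auto simp: H_def G_simps mat_mult)
  next
    fix a assume "a \<in> H"
    then obtain c where c: "c \<in> L" "a = mat c" by (auto simp: H_def)
    have "c \<in> K" using c LK by auto
    moreover have "c \<noteq> 0" using \<open>c \<in> K\<close> K0 by auto
    ultimately have "inv\<^bsub>G\<^esub> a = mat (inverse c)"
      using mat_in_G K_inverse by (intro group.inv_equality[OF group_G]) (auto simp: G_simps mat_mult c)
    then show "inv\<^bsub>G\<^esub> a \<in> H" using L_inverse[OF c(1)] by (auto simp: H_def)
  qed
  show "\<forall>x\<in>carrier G. H #>\<^bsub>G\<^esub> x = x <#\<^bsub>G\<^esub> H"
    by (auto simp: H_def r_coset_def l_coset_def G_simps) (metis mat_mult_commute)+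
qed

lemma subgroup_H: "subgroup H G"
  using normal_H by (simp add: normal_def)

lemma coset_mem: "B \<in> H #>\<^bsub>G\<^esub> A \<longleftrightarrow> (\<exists>c\<in>L. B = mat c ** A)"
  by (auto simp: H_def r_coset_def G_simps)

lemma coset_eqI: "A \<in> carrier G \<Longrightarrow> c \<in> L \<Longrightarrow> H #>\<^bsub>G\<^esub> (mat c ** A) = H #>\<^bsub>G\<^esub> A"
  using group.repr_independence[OF group_G _ _ subgroup_H, of "mat c ** A" A] coset_mem by blast

definition quot_rep :: "real ^ 6 ^ 6 \<Rightarrow> (complex ^ edge ^ edge) set" where
  "quot_rep N = H #>\<^bsub>G\<^esub> weyl_rep N"

lemma group_hom_quot_rep: "group_hom WeylD6 (G Mod H) quot_rep"
proof -
  have "weyl_rep \<in> hom WeylD6 G"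
    by (rule homI) (simp_all add: weyl_rep_in_G WeylD6_simps G_simps weyl_rep_mult)
  from hom_compose[OF this normal.r_coset_hom_Mod[OF normal_H]]
  have "quot_rep \<in> hom WeylD6 (G Mod H)" by (simp add: comp_def quot_rep_def[abs_def])
  then show ?thesis
    by (intro group_hom.intro group_hom_axioms.intro group_WeylD6 normal.factorgroup_is_group[OF normal_H])
qed

lemma quot_rep_surj: "quot_rep ` carrier WeylD6 = carrier (G Mod H)"
proof
  show "quot_rep ` carrier WeylD6 \<subseteq> carrier (G Mod H)"
    by (auto simp: carrier_FactGroup quot_rep_def weyl_rep_in_G)
  show "carrier (G Mod H) \<subseteq> quot_rep ` carrier WeylD6"
  proof
    fix C assume "C \<in> carrier (G Mod H)"
    then obtain \<mu> N where *: "\<mu> \<in> K" "N \<in> carrier WeylD6" "C = H #>\<^bsub>G\<^esub> (mat \<mu> ** weyl_rep N)"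
      by (auto simp: carrier_FactGroup G_carrier)
    show "C \<in> quot_rep ` carrier WeylD6"
    proof (cases "\<mu> \<in> L")
      case True
      then show ?thesis using * coset_eqI weyl_rep_in_G by (auto simp: quot_rep_def)
    next
      case False
      \<comment> \<open>The sign of the scalar is moved into the Weyl factor, which contains
        \<open>-1\<close>.\<close>
      then have "- \<mu> \<in> L" using K_sign *(1) by blast
      moreover have N: "mat (-1) ** N \<in> carrier WeylD6" using WeylD6_mult_closed WeylD6_scalar *(2) by blast
      moreover have "mat \<mu> ** weyl_rep N = mat (- \<mu>) ** weyl_rep (mat (-1) ** N)"
        by (simp add: weyl_rep_mult weyl_rep_mat mat_mult_mat)
      ultimately have "C = quot_rep (mat (-1) ** N)"
        using *(3) coset_eqI weyl_rep_in_G by (simp add: quot_rep_def)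
      then show ?thesis using N by blast
    qed
  qed
qed

text \<open>Both matrices have entries in \<open>{-1, 0, 1}\<close>, so a nonzero ratio is a sign.
  Whether \<open>-1\<close> lies in \<open>L\<close> then separates the complex quotient from the
  real one.\<close>

lemma quot_rep_eqD:
  assumes "M \<in> carrier WeylD6" "N \<in> carrier WeylD6" "quot_rep M = quot_rep N"
  obtains \<epsilon> where "\<epsilon> = 1 \<or> \<epsilon> = -1" "complex_of_real \<epsilon> \<in> L" "M = mat \<epsilon> ** N"
proof -
  have "weyl_rep M \<in> quot_rep N"
    using assms(3) group.rcos_self[OF group_G weyl_rep_in_G[OF assms(1)] subgroup_H] by (simp add: quot_rep_def)
  then obtain c where c: "c \<in> L" "weyl_rep M = mat c ** weyl_rep N" by (auto simp: quot_rep_def coset_mem)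
  note e = weyl_rep_scalar[OF c(2)]
  have ent: "M $ i $ j \<in> {-1, 0, 1}" "N $ i $ j \<in> {-1, 0, 1}" for i j
    using assms(1,2) by (simp_all add: WeylD6_def signed_perm_mat_def)
  have "\<exists>j. N $ 0 $ j \<noteq> 0" using assms(2) by (auto simp: WeylD6_def signed_perm_mat_def)
  then obtain j where j: "N $ 0 $ j \<noteq> 0" ..
  have "c \<noteq> 0" using c(1) LK K0 by auto
  define \<epsilon> where "\<epsilon> = M $ 0 $ j / N $ 0 $ j"
  have c\<epsilon>: "c = complex_of_real \<epsilon>" using e[of 0 j] j by (simp add: \<epsilon>_def)
  have "\<epsilon> \<in> {-1, 0, 1}" using ent[of 0 j] by (auto simp: \<epsilon>_def)
  then have \<epsilon>: "\<epsilon> = 1 \<or> \<epsilon> = -1" using \<open>c \<noteq> 0\<close> c\<epsilon> by auto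
  have "M = mat \<epsilon> ** N"
    using e unfolding c\<epsilon> by (simp add: vec_eq_iff mat_mult_nth flip: of_real_mult)
  then show ?thesis using that \<epsilon> c(1) c\<epsilon> by blast
qed

end

section \<open>Non-negative automorphisms\<close>

text \<open>Forgetting the order of the endpoints turns an edge permutation into taking images of
  vertex sets.\<close>

definition ends :: "edge \<Rightarrow> nat set" where
  "ends e = {fst (endpts e), snd (endpts e)}"

lemma ends_simps [simp]: "ends E01 = {0, 1}" "ends E02 = {0, 2}" "ends E03 = {0, 3}"
  "ends E12 = {1, 2}" "ends E13 = {1, 3}" "ends E23 = {2, 3}"
  by (simp_all add: ends_def)

lemma ends_eq_iff: "ends e = ends f \<longleftrightarrow> e = f"
  by (cases e; cases f) (simp_all add: doubleton_eq_iff)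

lemma ends_cases:
  obtains k l where "k \<in> {0..3}" "l \<in> {0..3}" "k \<noteq> l" "ends e = {k, l}"
  by (rule that[of "fst (endpts e)" "snd (endpts e)"]; cases e; simp add: ends_def)

lemma ex_edge: "(\<exists>e. P e) \<longleftrightarrow> P E01 \<or> P E02 \<or> P E03 \<or> P E12 \<or> P E13 \<or> P E23"
  by (metis edge.exhaust)

lemma less_4_cases: "k \<in> {0..3} \<longleftrightarrow> k = 0 \<or> k = 1 \<or> k = 2 \<or> k = (3::nat)"
  by auto

lemma ends_mk_edge:
  assumes "k \<in> {0..3}" "l \<in> {0..3}" "k \<noteq> l"
  shows "ends (mk_edge k l) = {k, l}"
proof -
  have "\<exists>e. endpts e = (min k l, max k l)"
    using assms unfolding less_4_cases
    by (elim disjE) (simp_all add: ex_edge)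
  then obtain e where e: "endpts e = (min k l, max k l)" ..
  have "mk_edge k l = e"
    unfolding mk_edge_def
  proof (rule the_equality[of _ e])
    fix d assume "endpts d = (min k l, max k l)"
    then have "ends d = ends e" using e by (simp add: ends_def)
    then show "d = e" by (simp add: ends_eq_iff)
  qed (rule e)
  then show ?thesis using e by (auto simp: ends_def min_def max_def)
qed

lemma two_other_vertices:
  assumes "k \<in> {0..3::nat}"
  obtains l l' where "l \<in> {0..3}" "l' \<in> {0..3}" "k \<noteq> l" "k \<noteq> l'" "l \<noteq> l'"
  by (rule that[of "if k = 0 then 1 else 0" "if k \<le> 1 then 2 else 1"]) auto

lemma edge_with_ends:
  assumes "k \<in> {0..3}" "l \<in> {0..3}" "k \<noteq> l"
  obtains e where "ends e = {k, l}"
  using ends_mk_edge[OF assms] by blast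

lemma ends_edge_perm:
  assumes "\<sigma> permutes {0..3}"
  shows "ends (edge_perm \<sigma> e) = \<sigma> ` ends e"
proof -
  have "fst (endpts e) \<in> {0..3}" "snd (endpts e) \<in> {0..3}" "fst (endpts e) \<noteq> snd (endpts e)"
    by (cases e; simp)+
  then show ?thesis
    unfolding edge_perm_def using assms permutes_in_image[OF assms] permutes_inj[OF assms]
    by (subst ends_mk_edge) (auto simp: ends_def inj_eq)
qed

lemma edge_perm_comp:
  assumes "\<sigma> permutes {0..3}" "\<tau> permutes {0..3}"
  shows "edge_perm (\<sigma> \<circ> \<tau>) e = edge_perm \<sigma> (edge_perm \<tau> e)"
  using assms by (simp add: ends_edge_perm permutes_compose image_comp flip: ends_eq_iff)

lemma edge_perm_id: "edge_perm id e = e"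
  using permutes_id[of "{0..3}"] by (simp add: ends_edge_perm flip: ends_eq_iff)

lemma inj_edge_perm:
  assumes "\<sigma> permutes {0..3}"
  shows "edge_perm \<sigma> e = edge_perm \<sigma> f \<longleftrightarrow> e = f"
  using permutes_inj[OF assms] by (simp add: ends_edge_perm[OF assms] inj_image_eq_iff flip: ends_eq_iff)

lemma perm_mat_comp:
  assumes "\<sigma> permutes {0..3}" "\<tau> permutes {0..3}"
  shows "perm_mat \<sigma> ** perm_mat \<tau> = perm_mat (\<sigma> \<circ> \<tau>)"
  by (simp add: vec_eq_iff matrix_matrix_mult_def perm_mat_def edge_perm_comp[OF assms]
      if_distrib[of "\<lambda>z. _ * z"] cong: if_cong)

lemma perm_mat_id: "perm_mat id = mat 1"
  by (simp add: vec_eq_iff perm_mat_def mat_def edge_perm_id)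

section \<open>Vertex permutations acting on \<open>L24\<close>\<close>

lemma mmap_nth:
  assumes "ends e = {k, l}"
  shows "mmap p $ e = (\<Sum>c\<in>UNIV. (p k $ c - p l $ c)\<^sup>2)"
proof -
  have "(fst (endpts e) = k \<and> snd (endpts e) = l) \<or> (fst (endpts e) = l \<and> snd (endpts e) = k)"
    using assms by (auto simp: ends_def doubleton_eq_iff)
  then show ?thesis by (auto simp: mmap_def power2_commute)
qed

lemma mmap_edge_perm:
  assumes "\<sigma> permutes {0..3}"
  shows "mmap p $ edge_perm \<sigma> e = mmap (p \<circ> \<sigma>) $ e"
proof -
  obtain k l where "ends e = {k, l}" using ends_cases[of e] by metis
  moreover have "ends (edge_perm \<sigma> e) = {\<sigma> k, \<sigma> l}" using calculation by (simp add: ends_edge_perm[OF assms])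
  ultimately show ?thesis by (simp add: mmap_nth)
qed

lemma perm_mat_mult_vec:
  assumes "\<sigma> permutes {0..3}"
  shows "(perm_mat \<sigma> *v v) $ edge_perm \<sigma> e = v $ e"
  by (simp add: perm_mat_def matrix_vector_mult_def inj_edge_perm[OF assms]
      if_distrib[of "\<lambda>z. z * _"] cong: if_cong)

text \<open>If the squared lengths come from a configuration \<open>p\<close>, the permuted ones
  come from \<open>p\<close> with its points relabeled by the inverse permutation.\<close>

lemma perm_mat_L24:
  assumes "\<sigma> permutes {0..3}" "v \<in> L24"
  shows "perm_mat \<sigma> *v v \<in> L24"
proof -
  obtain p where p: "sqmap v = mmap p" using assms(2) by (auto simp: L24_def M24_def)
  define \<tau> where "\<tau> = inv_into UNIV \<sigma>"
  have \<tau>: "\<tau> permutes {0..3}" "\<tau> \<circ> \<sigma> = id" "\<sigma> \<circ> \<tau> = id"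
    using assms(1) by (simp_all add: \<tau>_def permutes_inv permutes_inv_o)
  have "sqmap (perm_mat \<sigma> *v v) $ e = mmap (p \<circ> \<tau>) $ e" for e
  proof -
    have e: "edge_perm \<sigma> (edge_perm \<tau> e) = e"
      using edge_perm_comp[OF assms(1) \<tau>(1), of e] \<tau>(3) by (simp add: edge_perm_id)
    have "(perm_mat \<sigma> *v v) $ e = v $ edge_perm \<tau> e"
      using perm_mat_mult_vec[OF assms(1), of v "edge_perm \<tau> e"] by (simp add: e)
    moreover have "(v $ edge_perm \<tau> e)\<^sup>2 = mmap p $ edge_perm \<tau> e" using p by (simp add: sqmap_def vec_eq_iff)
    ultimately show ?thesis by (simp add: sqmap_def mmap_edge_perm[OF \<tau>(1)])
  qed
  then have "sqmap (perm_mat \<sigma> *v v) = mmap (p \<circ> \<tau>)" by (simp add: vec_eq_iff)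
  then show ?thesis by (auto simp: L24_def M24_def)
qed

lemma perm_mat_inverse:
  assumes "\<sigma> permutes {0..3}"
  shows "perm_mat \<sigma> ** perm_mat (inv_into UNIV \<sigma>) = mat 1" "perm_mat (inv_into UNIV \<sigma>) ** perm_mat \<sigma> = mat 1"
  using assms by (simp_all add: perm_mat_comp permutes_inv permutes_inv_o perm_mat_id)

lemma lin_aut_perm_mat:
  assumes "\<sigma> permutes {0..3}"
  shows "lin_aut (perm_mat \<sigma>)"
proof -
  have "v \<in> L24" if "perm_mat \<sigma> *v v \<in> L24" for v
    using perm_mat_L24[OF permutes_inv[OF assms] that] perm_mat_inverse(2)[OF assms]
    by (simp add: matrix_vector_mul_assoc)
  then show ?thesis
    unfolding lin_aut_iff invertible_def using perm_mat_L24[OF assms] perm_mat_inverse[OF assms] by blast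
qed

text \<open>Edge lengths of the degenerate configuration in which vertex \<open>k\<close> is at
  distance one from the other three, which coincide.\<close>

definition star :: "nat \<Rightarrow> complex ^ edge" where
  "star k = (\<chi> e. if k \<in> ends e then 1 else 0)"

text \<open>Each pair of opposite edges has exactly one member at \<open>k\<close>, so its sum is 1
  and its difference is a sign; the orientation chosen in \<open>Bmat\<close> makes the sign count
  odd.\<close>

lemma star_triple_point:
  assumes "k \<in> {0..3}"
  shows "triple_point (\<lambda>e. (Bmat *v star k) $ e)"
proof (rule sign_triple_point)
  show "(Bmat *v star k) $ e = 1 \<or> (Bmat *v star k) $ e = -1" for e
    using assms unfolding less_4_cases by (cases e) (auto simp: Bmat_mult_vec star_def)
  show "(\<Prod>e\<in>UNIV. (Bmat *v star k) $ e) = -1"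
    using assms unfolding less_4_cases by (auto simp: prod_edge Bmat_mult_vec star_def)
qed

text \<open>Equal squares of sum and difference kill one edge of each opposite pair, and
  non-negativity makes the three survivors equal. Of the eight choices of survivors four are stars
  and four are triangles; the sign in the product formula rules out the triangles.\<close>

lemma nonneg_triple_point:
  fixes v :: "complex ^ edge"
  assumes trip: "triple_point (\<lambda>e. (Bmat *v v) $ e)" and "v \<noteq> 0"
    and nonneg: "\<And>e. v $ e \<in> \<real> \<and> Re (v $ e) \<ge> 0"
  obtains k m where "k \<in> {0..3}" "m > 0" "v = complex_of_real m *s star k"
proof -
  define r where "r e = Re (v $ e)" for e
  have v: "v $ e = complex_of_real (r e)" and r0: "r e \<ge> 0" for e using nonneg[of e] by (simp_all add: r_def)
  define a b c d f g where "a = r E01" and "b = r E02" and "c = r E03" and "d = r E12" and "f = r E13" and "g = r E23"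
  note defs = a_def b_def c_def d_def f_def g_def
  note vs = v[of E01, folded a_def] v[of E02, folded b_def] v[of E03, folded c_def]
      v[of E12, folded d_def] v[of E13, folded f_def] v[of E23, folded g_def]
  have ge: "a \<ge> 0" "b \<ge> 0" "c \<ge> 0" "d \<ge> 0" "f \<ge> 0" "g \<ge> 0" using r0 by (simp_all add: defs)
  note sq = triple_point_imp_equal_squares(1)[OF trip]
  have "(complex_of_real (g - a))\<^sup>2 = (complex_of_real (g + a))\<^sup>2" using sq[of E01 E23] by (simp add: Bmat_mult_vec vs)
  then have 1: "(g - a)\<^sup>2 = (g + a)\<^sup>2" by (metis of_real_eq_iff of_real_power)
  have "(complex_of_real (f - b))\<^sup>2 = (complex_of_real (f + b))\<^sup>2" using sq[of E02 E13] by (simp add: Bmat_mult_vec vs)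
  then have 2: "(f - b)\<^sup>2 = (f + b)\<^sup>2" by (metis of_real_eq_iff of_real_power)
  have "(complex_of_real (d - c))\<^sup>2 = (complex_of_real (d + c))\<^sup>2" using sq[of E03 E12] by (simp add: Bmat_mult_vec vs)
  then have 3: "(d - c)\<^sup>2 = (d + c)\<^sup>2" by (metis of_real_eq_iff of_real_power)
  have "(complex_of_real (g + a))\<^sup>2 = (complex_of_real (f + b))\<^sup>2" using sq[of E23 E13] by (simp add: Bmat_mult_vec vs)
  then have 4: "(g + a)\<^sup>2 = (f + b)\<^sup>2" by (metis of_real_eq_iff of_real_power)
  have "(complex_of_real (g + a))\<^sup>2 = (complex_of_real (d + c))\<^sup>2" using sq[of E23 E12] by (simp add: Bmat_mult_vec vs)
  then have 5: "(g + a)\<^sup>2 = (d + c)\<^sup>2" by (metis of_real_eq_iff of_real_power)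
  have "complex_of_real ((g - a) * (f - b) * (d - c) * (d + c) * (f + b) * (g + a)) = complex_of_real (- (((g + a)\<^sup>2) ^ 3))"
    using triple_point_imp_equal_squares(2)[OF trip, of E23] by (simp add: Bmat_mult_vec vs prod_edge)
  then have 6: "(g - a) * (f - b) * (d - c) * (d + c) * (f + b) * (g + a) = - (((g + a)\<^sup>2) ^ 3)"
    by (simp only: of_real_eq_iff)
  have z: "a = 0 \<or> g = 0" "b = 0 \<or> f = 0" "c = 0 \<or> d = 0"
    using 1 2 3 by (auto simp: power2_eq_square algebra_simps)
  have e4: "g + a = f + b" and e5: "g + a = d + c"
    using 4 5 ge by (simp_all add: power2_eq_iff_nonneg)
  define m where "m = g + a"
  have m: "m \<noteq> 0"
  proof
    assume "m = 0"
    then have "a = 0" "b = 0" "c = 0" "d = 0" "f = 0" "g = 0" using ge e4 e5 unfolding m_def by linarith+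
    then have "v = 0" unfolding vec_eq_iff all_edge by (simp add: vs)
    then show False using \<open>v \<noteq> 0\<close> by simp
  qed
  then have "m > 0" using ge by (simp add: m_def)
  have sums: "g + a = m" "f + b = m" "d + c = m" using e4 e5 by (simp_all add: m_def)
  have "(g - a) * (f - b) * (d - c) * (m * m * m) = - (m * m * m) * (m * m * m)"
    using 6 unfolding sums by (simp add: mult.assoc power2_eq_square power3_eq_cube)
  then have 6: "(g - a) * (f - b) * (d - c) = - (m * m * m)" using m by (simp only: mult_cancel_right) simp
  have "m * m * m > 0" using \<open>m > 0\<close> by simp
  have star: "v = complex_of_real m *s star k \<longleftrightarrow> (\<forall>e. r e = (if k \<in> ends e then m else 0))" for k
    by (auto simp: vec_eq_iff v star_def of_real_eq_iff) 
  have "v = complex_of_real m *s star 0 \<or> v = complex_of_real m *s star 1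
      \<or> v = complex_of_real m *s star 2 \<or> v = complex_of_real m *s star 3"
    unfolding star all_edge ends_simps defs[symmetric]
    using z sums m 6 \<open>m * m * m > 0\<close> by (elim disjE) simp_all
  then show ?thesis using that[of 0 m] that[of 1 m] that[of 2 m] that[of 3 m] \<open>m > 0\<close> by auto
qed


lemma star_proportional:
  assumes "k \<in> {0..3}" "l \<in> {0..3}" "star k = c *s star l"
  shows "k = l"
proof (rule ccontr)
  assume "k \<noteq> l"
  then obtain j where j: "j \<in> {0..3}" "j \<noteq> k" "j \<noteq> l"
    using two_other_vertices[OF assms(1)] by metis
  obtain e where "ends e = {k, j}" using edge_with_ends[of k j] assms(1) j by metis
  then have "star k $ e = 1" "star l $ e = 0" using j \<open>k \<noteq> l\<close> by (simp_all add: star_def)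
  then show False using assms(3) by (simp add: vec_eq_iff)
qed

text \<open>The image of a star is a non-negative nonzero triple point, hence a positive multiple of
  a star. This determines sums of entries over stars, and non-negativity recovers the individual
  entries.\<close>

lemma nonneg_lin_aut_is_perm_mat:
  assumes A: "lin_aut A" and nonneg: "\<And>i j. A $ i $ j \<in> \<real> \<and> Re (A $ i $ j) \<ge> 0"
  obtains m \<sigma> where "m > 0" "\<sigma> permutes {0..3}" "A = mat (complex_of_real m) ** perm_mat \<sigma>"
proof -
  define a where "a i j = Re (A $ i $ j)" for i j
  have Aa: "A $ i $ j = complex_of_real (a i j)" and a0: "a i j \<ge> 0" for i j
    using nonneg[of i j] by (simp_all add: a_def)
  have inj: "x = y" if "A *v x = A *v y" for x y
    using A that by (metis lin_aut_iff invertible_def matrix_vector_mul_assoc matrix_vector_mul_lid)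
  have As: "(A *v star k) $ i = complex_of_real (\<Sum>e | k \<in> ends e. a i e)" for k i
  proof -
    have "(A *v star k) $ i = (\<Sum>e\<in>UNIV. if k \<in> ends e then complex_of_real (a i e) else 0)"
      unfolding matrix_vector_mult_def star_def by (simp add: Aa if_distrib[of "\<lambda>z. _ * z"] cong: if_cong)
    also have "\<dots> = (\<Sum>e | k \<in> ends e. complex_of_real (a i e))" by (simp flip: sum.inter_filter)
    finally show ?thesis by simp
  qed
  have "\<exists>l m. l \<in> {0..3} \<and> m > 0 \<and> A *v star k = complex_of_real m *s star l" if k: "k \<in> {0..3}" for k
  proof -
    have "triple_point (\<lambda>e. (Bmat *v (A *v star k)) $ e)"
      using triple_point_of_lin_aut(2)[OF A star_triple_point[OF k]]
        Bmat_mult_edge_coords[of "edge_coords A" "star k"] by (simp add: edge_coords_idem)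
    moreover have "A *v star k \<noteq> 0"
    proof
      assume "A *v star k = 0"
      then have "star k = 0" using inj[of "star k" 0] by simp
      moreover obtain e where "k \<in> ends e" using k unfolding less_4_cases by (metis ends_simps(1,6) insertCI)
      then have "star k $ e = 1" by (simp add: star_def)
      ultimately show False by simp
    qed
    moreover have "(A *v star k) $ e \<in> \<real> \<and> Re ((A *v star k) $ e) \<ge> 0" for e
      unfolding As by (simp add: a0 sum_nonneg)
    ultimately show ?thesis using nonneg_triple_point by metis
  qed
  then obtain s m where s: "\<And>k. k \<in> {0..3} \<Longrightarrow> s k \<in> {0..3}" and m: "\<And>k. k \<in> {0..3} \<Longrightarrow> m k > 0"
    and A_star: "\<And>k. k \<in> {0..3} \<Longrightarrow> A *v star k = complex_of_real (m k) *s star (s k)" by metis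
  have "inj_on s {0..3}"
  proof (rule inj_onI)
    fix k l assume kl: "k \<in> {0..3}" "l \<in> {0..3}" "s k = s l"
    have "A *v star k = A *v (complex_of_real (m k / m l) *s star l)"
      using A_star[OF kl(1)] A_star[OF kl(2)] m[OF kl(2)] kl(3)
      by (simp add: vector_scalar_commute)
    then show "k = l" using inj star_proportional[OF kl(1,2)] by blast
  qed
  then have bij: "bij_betw s {0..3} {0..3}"
    using s endo_inj_surj[of "{0..3}" s] by (simp add: bij_betw_def image_subset_iff)
  define \<sigma> where "\<sigma> k = (if k \<in> {0..3} then s k else k)" for k
  have \<sigma>: "\<sigma> permutes {0..3}"
  proof (rule bij_imp_permutes)
    show "bij_betw \<sigma> {0..3} {0..3}" using bij by (subst bij_betw_cong[of _ _ s]) (simp_all add: \<sigma>_def)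
  qed (simp add: \<sigma>_def)
  have row: "(\<Sum>e | k \<in> ends e. a i e) = (if \<sigma> k \<in> ends i then m k else 0)" if "k \<in> {0..3}" for k i
  proof -
    have "complex_of_real (\<Sum>e | k \<in> ends e. a i e) = complex_of_real (if \<sigma> k \<in> ends i then m k else 0)"
      unfolding As[symmetric] A_star[OF that] using that by (simp add: star_def \<sigma>_def)
    then show ?thesis by (simp only: of_real_eq_iff)
  qed
  \<comment> \<open>A vanishing sum of non-negative entries has only vanishing terms.\<close>
  have zero: "a i e = 0" if "k \<in> {0..3}" "k \<in> ends e" "\<sigma> k \<notin> ends i" for k i e
  proof -
    have "(\<Sum>e | k \<in> ends e. a i e) = 0" using row that by simp
    then show ?thesis using that(2) by (simp add: sum_nonneg_eq_0_iff a0)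
  qed
  have off: "a i e = 0" if "i \<noteq> edge_perm \<sigma> e" for i e
  proof (rule ccontr)
    assume "a i e \<noteq> 0"
    obtain k l where kl: "k \<in> {0..3}" "l \<in> {0..3}" "k \<noteq> l" "ends e = {k, l}" using ends_cases .
    \<comment> \<open>A nonzero entry in column \<open>e\<close> needs a row meeting the images of
      both endpoints, which leaves a single edge.\<close>
    have "{\<sigma> k, \<sigma> l} \<subseteq> ends i" using zero[of k e i] zero[of l e i] kl \<open>a i e \<noteq> 0\<close> by auto
    moreover have "\<sigma> k \<noteq> \<sigma> l" using permutes_inj[OF \<sigma>] kl(3) by (simp add: inj_eq)
    moreover obtain k' l' where "ends i = {k', l'}" using ends_cases[of i] .
    ultimately have "ends i = {\<sigma> k, \<sigma> l}" by auto
    then have "ends i = ends (edge_perm \<sigma> e)" by (simp add: ends_edge_perm[OF \<sigma>] kl(4))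
    then show False using that by (simp add: ends_eq_iff)
  qed
  have on: "a (edge_perm \<sigma> e) e = m k" if "k \<in> {0..3}" "k \<in> ends e" for k e
  proof -
    have "(\<Sum>f | k \<in> ends f. a (edge_perm \<sigma> e) f) = (\<Sum>f | k \<in> ends f. if f = e then a (edge_perm \<sigma> e) e else 0)"
      using off inj_edge_perm[OF \<sigma>] by (intro sum.cong) auto
    then show ?thesis
      using row[OF that(1), of "edge_perm \<sigma> e"] that(2) by (simp add: ends_edge_perm[OF \<sigma>])
  qed
  \<comment> \<open>The edge joining \<open>k\<close> and 0 belongs to both stars, so its one
    nonzero entry equals both factors.\<close>
  have "m k = m 0" if "k \<in> {0..3}" for k
  proof (cases "k = 0")
    case False
    obtain e where e: "ends e = {k, 0}" by (rule edge_with_ends[of k 0]) (use \<open>k \<in> {0..3}\<close> False in auto)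
    show ?thesis using on[of k e] on[of 0 e] that e by simp
  qed simp
  then have "a (edge_perm \<sigma> e) e = m 0" for e
    using on ends_cases[of e] by (metis insertI1)
  then have "A = mat (complex_of_real (m 0)) ** perm_mat \<sigma>"
    using off by (auto simp: vec_eq_iff mat_mult_nth perm_mat_def Aa)
  then show ?thesis using that m[of 0] \<sigma> by simp
qed

text \<open>A vertex is the intersection of two of its edges. If the images of \<open>k\<close>
  differed, two such edges would force \<tau> to take the same value at two further
  vertices.\<close>

lemma perm_mat_inj:
  assumes \<sigma>: "\<sigma> permutes {0..3}" and \<tau>: "\<tau> permutes {0..3}" and eq: "perm_mat \<sigma> = mat c ** perm_mat \<tau>"
  shows "\<sigma> = \<tau>"
proof -
  have ep: "edge_perm \<sigma> e = edge_perm \<tau> e" for e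
  proof -
    have "perm_mat \<sigma> $ edge_perm \<sigma> e $ e = c * perm_mat \<tau> $ edge_perm \<sigma> e $ e" unfolding eq mat_mult_nth ..
    then show ?thesis by (simp add: perm_mat_def split: if_splits)
  qed
  have im: "\<sigma> ` {k, l} = \<tau> ` {k, l}" if kl: "k \<in> {0..3}" "l \<in> {0..3}" "k \<noteq> l" for k l
  proof -
    obtain e where "ends e = {k, l}" using edge_with_ends[OF kl] .
    then show ?thesis using ep[of e] ends_edge_perm[OF \<sigma>, of e] ends_edge_perm[OF \<tau>, of e] by simp
  qed
  show ?thesis
  proof
    fix k show "\<sigma> k = \<tau> k"
    proof (cases "k \<in> {0..3}")
      case True
      then obtain l l' where l: "l \<in> {0..3}" "l' \<in> {0..3}" "k \<noteq> l" "k \<noteq> l'" "l \<noteq> l'"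
        using two_other_vertices by metis
      show ?thesis
      proof (rule ccontr)
        assume "\<sigma> k \<noteq> \<tau> k"
        then have "\<sigma> k = \<tau> l" "\<sigma> k = \<tau> l'" using im[OF True l(1,3)] im[OF True l(2,4)] by auto
        then show False using permutes_inj[OF \<tau>] l(5) by (metis injD)
      qed
    next
      case False
      then show ?thesis using \<sigma> \<tau> by (simp add: permutes_not_in)
    qed
  qed
qed

section \<open>The quotient groups\<close>

interpretation P: scalar_quotient "- {0}" "- {0}"
  by unfold_locales auto

interpretation R: scalar_quotient "\<real> - {0}" "{complex_of_real r | r. r > 0}"
proof
  show "x \<in> {complex_of_real r | r. r > 0} \<or> - x \<in> {complex_of_real r | r. r > 0}" if x: "x \<in> \<real> - {0}" for x
  proof -
    obtain r where r: "x = complex_of_real r" "r \<noteq> 0" using x by (auto elim: Reals_cases)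
    show ?thesis
    proof (cases "r > 0")
      case False
      then have "- x = complex_of_real (- r)" "- r > 0" using r by auto
      then show ?thesis by blast
    qed (use r in blast)
  qed
  show "inverse x \<in> {complex_of_real r | r. r > 0}" if x: "x \<in> {complex_of_real r | r. r > 0}" for x
  proof -
    obtain r where "x = complex_of_real r" "r > 0" using x by blast
    then show ?thesis by (auto intro!: exI[of _ "inverse r"])
  qed
  show "x * y \<in> {complex_of_real r | r. r > 0}" if xy: "x \<in> {complex_of_real r | r. r > 0}" "y \<in> {complex_of_real r | r. r > 0}" for x y
  proof -
    obtain r s where "x = complex_of_real r" "r > 0" "y = complex_of_real s" "s > 0" using xy by blast
    then show ?thesis by (auto intro!: exI[of _ "r * s"])
  qed
qed (auto intro: exI[of _ 1])

lemma Aut_eq: "Aut = P.G"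
proof -
  have "lin_aut A \<longleftrightarrow> A \<in> carrier P.G" for A
    unfolding P.G_carrier using lin_aut_eq_weyl_rep[of A] lin_aut_scalar_mult lin_aut_weyl_rep
    by (metis Compl_iff singletonI singletonD)
  then show ?thesis by (simp add: Aut_def) (simp add: P.G_def)
qed

lemma AutR_eq: "AutR = R.G"
proof -
  have "lin_aut A \<and> (\<forall>i j. A $ i $ j \<in> \<real>) \<longleftrightarrow> A \<in> carrier R.G" for A
  proof
    assume A: "lin_aut A \<and> (\<forall>i j. A $ i $ j \<in> \<real>)"
    then obtain \<mu> N where *: "\<mu> \<noteq> 0" "N \<in> carrier WeylD6" "A = mat \<mu> ** weyl_rep N"
      using lin_aut_eq_weyl_rep by blast
    have "\<mu> \<in> \<real>" using real_lin_aut_scalar lin_aut_weyl_rep[OF *(2)] A *(3) by blast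
    then show "A \<in> carrier R.G" using * R.G_carrier by blast
  next
    assume "A \<in> carrier R.G"
    then obtain \<mu> N where *: "\<mu> \<in> \<real> - {0}" "N \<in> carrier WeylD6" "A = mat \<mu> ** weyl_rep N"
      using R.G_carrier by blast
    then show "lin_aut A \<and> (\<forall>i j. A $ i $ j \<in> \<real>)"
      using lin_aut_scalar_mult lin_aut_weyl_rep by (auto simp: mat_mult_nth weyl_rep_real intro!: Reals_mult)
  qed
  then show ?thesis by (simp add: AutR_def) (simp add: R.G_def)
qed

lemma scalars_eq: "scalars = P.H"
  by (auto simp: scalars_def P.H_def)

lemma pos_scalars_eq: "pos_scalars = R.H"
  by (auto simp: pos_scalars_def R.H_def)

lemma PAut_eq: "PAut = P.G Mod P.H"
  by (simp add: PAut_def Aut_eq scalars_eq)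

lemma PAutR_eq: "PAutR = R.G Mod R.H"
  by (simp add: PAutR_def AutR_eq pos_scalars_eq)

text \<open>The only candidate for a nontrivial kernel element is \<open>-1\<close>, which is not a
  positive scalar.\<close>

lemma PAutR_iso_WeylD6: "PAutR \<cong> WeylD6"
proof -
  have "inj_on R.quot_rep (carrier WeylD6)"
  proof (rule inj_onI)
    fix M N assume "M \<in> carrier WeylD6" "N \<in> carrier WeylD6" "R.quot_rep M = R.quot_rep N"
    then obtain \<epsilon> where \<epsilon>: "\<epsilon> = 1 \<or> \<epsilon> = -1" "complex_of_real \<epsilon> \<in> {complex_of_real r | r. r > 0}" "M = mat \<epsilon> ** N"
      by (rule R.quot_rep_eqD)
    then have "\<epsilon> = 1" by auto
    then show "M = N" using \<epsilon>(3) by simp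
  qed
  then have "R.quot_rep \<in> iso WeylD6 PAutR"
    using R.quot_rep_surj group_hom.homh[OF R.group_hom_quot_rep] unfolding PAutR_eq iso_def bij_betw_def by blast
  then show ?thesis using group.iso_sym[OF group_WeylD6] is_isoI by blast
qed

text \<open>Here \<open>-1\<close> is a permitted scalar, so the kernel has exactly two elements and
  Lagrange halves 23040.\<close>

lemma order_PAut: "order PAut = 11520"
proof -
  let ?K = "kernel WeylD6 PAut P.quot_rep"
  have hom: "group_hom WeylD6 PAut P.quot_rep" unfolding PAut_eq by (rule P.group_hom_quot_rep)
  have one: "P.quot_rep (mat 1) = \<one>\<^bsub>PAut\<^esub>"
    using group_hom.hom_one[OF hom] by (simp add: WeylD6_simps)
  have "?K = {mat 1, mat (-1)}"
  proof
    show "?K \<subseteq> {mat 1, mat (-1)}"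
    proof
      fix N assume "N \<in> ?K"
      then have "N \<in> carrier WeylD6" "P.quot_rep N = P.quot_rep (mat 1)" by (auto simp: kernel_def one)
      then obtain \<epsilon> where "\<epsilon> = 1 \<or> \<epsilon> = -1" "N = mat \<epsilon> ** mat 1"
        using P.quot_rep_eqD[of N "mat 1"] WeylD6_scalar[of 1] by blast
      then show "N \<in> {mat 1, mat (-1)}" by auto
    qed
    have "P.quot_rep (mat (-1)) = P.quot_rep (mat 1)"
      using P.coset_eqI[of "mat 1" "-1"] P.mat_in_G[of 1] by (simp add: P.quot_rep_def weyl_rep_mat)
    then show "{mat 1, mat (-1)} \<subseteq> ?K" using one WeylD6_scalar by (simp add: kernel_def)
  qed
  moreover have "(mat 1 :: real ^ 6 ^ 6) \<noteq> mat (-1)"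
    by (auto simp: vec_eq_iff mat_def intro!: exI[of _ 0])
  ultimately have "card ?K = 2" by simp
  moreover have "card (rcosets\<^bsub>WeylD6\<^esub> ?K) * card ?K = order WeylD6"
    by (rule group.lagrange[OF group_WeylD6 group_hom.subgroup_kernel[OF hom]])
  moreover have "card (rcosets\<^bsub>WeylD6\<^esub> ?K) = order PAut"
  proof -
    have "(\<lambda>X. the_elem (P.quot_rep ` X)) \<in> iso (WeylD6 Mod ?K) PAut"
      using group_hom.FactGroup_iso_set[OF hom] P.quot_rep_surj by (simp add: PAut_eq)
    then have "card (carrier (WeylD6 Mod ?K)) = card (carrier PAut)"
      unfolding iso_def using bij_betw_same_card by blast
    then show ?thesis by (simp add: order_def FactGroup_def)
  qed
  ultimately show ?thesis by (simp add: order_WeylD6)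
qed

lemma group_PAut: "group PAut"
  unfolding PAut_eq by (rule normal.factorgroup_is_group[OF P.normal_H])

lemma group_PAutR: "group PAutR"
  unfolding PAutR_eq by (rule normal.factorgroup_is_group[OF R.normal_H])

text \<open>Every class already contains a rational matrix, namely some \<open>weyl_rep N\<close>,
  so the generating set is the whole group.\<close>

lemma PAut_generated_by_rational:
  "carrier PAut = generate PAut {C \<in> carrier PAut. \<exists>A\<in>C. \<forall>i j. A $ i $ j \<in> \<rat>}" (is "_ = generate _ ?S")
proof
  have "C \<in> ?S" if C: "C \<in> carrier PAut" for C
  proof -
    obtain N where N: "N \<in> carrier WeylD6" "C = P.quot_rep N"
      using C P.quot_rep_surj by (auto simp: PAut_eq)
    have "weyl_rep N \<in> C"
      using N group.rcos_self[OF P.group_G P.weyl_rep_in_G P.subgroup_H] by (simp add: P.quot_rep_def)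
    then show ?thesis using C weyl_rep_rational[OF N(1)] by blast
  qed
  then show "carrier PAut \<subseteq> generate PAut ?S" by (blast intro: generate.incl)
  show "generate PAut ?S \<subseteq> carrier PAut"
    by (rule group.generate_incl[OF group_PAut]) blast
qed

section \<open>The subgroup of non-negative classes\<close>

lemma perm_mat_in_AutR: "\<sigma> permutes {0..3} \<Longrightarrow> perm_mat \<sigma> \<in> carrier AutR"
  by (simp add: AutR_def lin_aut_perm_mat) (simp add: perm_mat_def)

lemma nonneg_classes_eq:
  "nonneg_classes = {pos_scalars #>\<^bsub>AutR\<^esub> perm_mat \<sigma> | \<sigma>. \<sigma> permutes {0..3}}"
proof (intro equalityI subsetI)
  fix C assume "C \<in> nonneg_classes"
  then obtain A where C: "C \<in> carrier PAutR" and A: "A \<in> C" "\<And>i j. A $ i $ j \<in> \<real> \<and> Re (A $ i $ j) \<ge> 0"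
    unfolding nonneg_classes_def by blast
  obtain A' where A': "A' \<in> carrier R.G" "C = R.H #>\<^bsub>R.G\<^esub> A'"
    using C by (auto simp: PAutR_eq carrier_FactGroup)
  have CA: "C = R.H #>\<^bsub>R.G\<^esub> A"
    using group.repr_independence[OF R.group_G _ A'(1) R.subgroup_H] A(1) A'(2) by blast
  have "A \<in> carrier R.G"
    using A(1) A' monoid.r_coset_subset_G[OF group.is_monoid[OF R.group_G] subgroup.subset[OF R.subgroup_H]] by blast
  then have "lin_aut A" by (simp add: AutR_eq[symmetric] AutR_def)
  then obtain m \<sigma> where m: "m > 0" "\<sigma> permutes {0..3}" "A = mat (complex_of_real m) ** perm_mat \<sigma>"
    using nonneg_lin_aut_is_perm_mat A(2) by blast
  have "C = R.H #>\<^bsub>R.G\<^esub> perm_mat \<sigma>"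
    using R.coset_eqI[of "perm_mat \<sigma>" "complex_of_real m"] perm_mat_in_AutR[OF m(2)] m
    unfolding CA AutR_eq by blast
  then show "C \<in> {pos_scalars #>\<^bsub>AutR\<^esub> perm_mat \<sigma> | \<sigma>. \<sigma> permutes {0..3}}"
    using m(2) by (auto simp: AutR_eq pos_scalars_eq)
next
  fix C assume "C \<in> {pos_scalars #>\<^bsub>AutR\<^esub> perm_mat \<sigma> | \<sigma>. \<sigma> permutes {0..3}}"
  then obtain \<sigma> where \<sigma>: "\<sigma> permutes {0..3}" "C = R.H #>\<^bsub>R.G\<^esub> perm_mat \<sigma>"
    by (auto simp: AutR_eq pos_scalars_eq)
  have mem: "perm_mat \<sigma> \<in> carrier R.G" using perm_mat_in_AutR[OF \<sigma>(1)] by (simp add: AutR_eq)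
  then have "perm_mat \<sigma> \<in> C" using \<sigma>(2) group.rcos_self[OF R.group_G _ R.subgroup_H] by blast
  moreover have "C \<in> carrier PAutR" using mem \<sigma>(2) by (auto simp: PAutR_eq carrier_FactGroup)
  moreover have "perm_mat \<sigma> $ i $ j \<in> \<real> \<and> Re (perm_mat \<sigma> $ i $ j) \<ge> 0" for i j
    by (simp add: perm_mat_def)
  ultimately show "C \<in> nonneg_classes" unfolding nonneg_classes_def by blast
qed

lemma perm_class_mult:
  assumes "\<sigma> permutes {0..3}" "\<tau> permutes {0..3}"
  shows "(pos_scalars #>\<^bsub>AutR\<^esub> perm_mat \<sigma>) \<otimes>\<^bsub>PAutR\<^esub> (pos_scalars #>\<^bsub>AutR\<^esub> perm_mat \<tau>)
    = pos_scalars #>\<^bsub>AutR\<^esub> perm_mat (\<sigma> \<circ> \<tau>)"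
  using normal.rcos_sum[OF R.normal_H, of "perm_mat \<sigma>" "perm_mat \<tau>"] assms[THEN perm_mat_in_AutR]
  by (simp add: PAutR_eq AutR_eq pos_scalars_eq R.G_simps perm_mat_comp[OF assms])

text \<open>Non-negative matrices are not closed under inversion in general; the description by
  vertex permutations supplies the inverses.\<close>

lemma subgroup_nonneg_classes: "subgroup nonneg_classes PAutR"
proof (rule group.subgroupI[OF group_PAutR])
  show sub: "nonneg_classes \<subseteq> carrier PAutR" by (auto simp: nonneg_classes_def)
  show "nonneg_classes \<noteq> {}" unfolding nonneg_classes_eq using permutes_id by blast
  show "a \<otimes>\<^bsub>PAutR\<^esub> b \<in> nonneg_classes" if "a \<in> nonneg_classes" "b \<in> nonneg_classes" for a b
  proof -
    obtain \<sigma> \<tau> where \<sigma>: "\<sigma> permutes {0..3}" "a = pos_scalars #>\<^bsub>AutR\<^esub> perm_mat \<sigma>"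
      and \<tau>: "\<tau> permutes {0..3}" "b = pos_scalars #>\<^bsub>AutR\<^esub> perm_mat \<tau>"
      using \<open>a \<in> nonneg_classes\<close> \<open>b \<in> nonneg_classes\<close> unfolding nonneg_classes_eq by blast
    have "\<sigma> \<circ> \<tau> permutes {0..3}" using permutes_compose \<sigma>(1) \<tau>(1) by blast
    then show ?thesis
      unfolding \<sigma>(2) \<tau>(2) perm_class_mult[OF \<sigma>(1) \<tau>(1)] nonneg_classes_eq by blast
  qed
  show "inv\<^bsub>PAutR\<^esub> a \<in> nonneg_classes" if "a \<in> nonneg_classes" for a
  proof -
    obtain \<sigma> where \<sigma>: "\<sigma> permutes {0..3}" "a = pos_scalars #>\<^bsub>AutR\<^esub> perm_mat \<sigma>"
      using \<open>a \<in> nonneg_classes\<close> unfolding nonneg_classes_eq by blast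
    define b where "b = pos_scalars #>\<^bsub>AutR\<^esub> perm_mat (inv_into UNIV \<sigma>)"
    have b: "b \<in> nonneg_classes" unfolding nonneg_classes_eq b_def using permutes_inv[OF \<sigma>(1)] by blast
    have "b \<otimes>\<^bsub>PAutR\<^esub> a = pos_scalars #>\<^bsub>AutR\<^esub> mat 1"
      unfolding b_def \<sigma>(2) perm_class_mult[OF permutes_inv[OF \<sigma>(1)] \<sigma>(1)] permutes_inv_o(2)[OF \<sigma>(1)] perm_mat_id ..
    also have "\<dots> = \<one>\<^bsub>PAutR\<^esub>"
      using group.coset_join2[OF R.group_G _ R.subgroup_H, of "mat 1"] subgroup.one_closed[OF R.subgroup_H]
        monoid.one_closed[OF group.is_monoid[OF R.group_G]]
      by (simp add: AutR_eq pos_scalars_eq PAutR_eq R.G_simps)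
    finally have "inv\<^bsub>PAutR\<^esub> a = b"
      using sub that b by (intro group.inv_equality[OF group_PAutR]) auto
    then show ?thesis using b by simp
  qed
qed

lemma card_nonneg_classes: "card nonneg_classes = 24"
proof -
  have "nonneg_classes = (\<lambda>\<sigma>. pos_scalars #>\<^bsub>AutR\<^esub> perm_mat \<sigma>) ` {\<sigma>. \<sigma> permutes {0..3}}"
    unfolding nonneg_classes_eq by blast
  moreover have "inj_on (\<lambda>\<sigma>. pos_scalars #>\<^bsub>AutR\<^esub> perm_mat \<sigma>) {\<sigma>. \<sigma> permutes {0..3}}"
  proof (rule inj_onI, unfold mem_Collect_eq)
    fix \<sigma> \<tau> assume \<sigma>: "\<sigma> permutes {0..3}" and \<tau>: "\<tau> permutes {0..3}"
      and eq: "pos_scalars #>\<^bsub>AutR\<^esub> perm_mat \<sigma> = pos_scalars #>\<^bsub>AutR\<^esub> perm_mat \<tau>"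
    have "perm_mat \<sigma> \<in> R.H #>\<^bsub>R.G\<^esub> perm_mat \<tau>"
      using group.rcos_self[OF R.group_G perm_mat_in_AutR[OF \<sigma>, unfolded AutR_eq] R.subgroup_H]
        eq[unfolded AutR_eq pos_scalars_eq] by blast
    then show "\<sigma> = \<tau>" using perm_mat_inj[OF \<sigma> \<tau>] R.coset_mem by blast
  qed
  moreover have "card {\<sigma>. \<sigma> permutes {0..3::nat}} = fact 4" by (rule card_permutations) simp_all
  moreover have "fact 4 = (24::nat)" by (simp add: fact_numeral)
  ultimately show ?thesis by (metis card_image)
qed

theorem theorem5p15:
  shows "order PAut = 11520
    \<and> carrier PAut = generate PAut {C \<in> carrier PAut. \<exists>A\<in>C. \<forall>i j. A $ i $ j \<in> \<rat>}
    \<and> order PAutR = 23040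
    \<and> PAutR \<cong> WeylD6
    \<and> subgroup nonneg_classes PAutR
    \<and> card nonneg_classes = 24
    \<and> nonneg_classes = {pos_scalars #>\<^bsub>AutR\<^esub> perm_mat \<sigma> | \<sigma>. \<sigma> permutes {0..3}}"
proof -
  have "order PAutR = 23040"
    using PAutR_iso_WeylD6 order_WeylD6 unfolding is_iso_def iso_def order_def
    by (auto dest: bij_betw_same_card)
  then show ?thesis
    using order_PAut PAut_generated_by_rational PAutR_iso_WeylD6 subgroup_nonneg_classes
      card_nonneg_classes nonneg_classes_eq by blast
qed

end
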